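(* Let $(\mu_k,L_k,T_k)_{0\le k<N+1}$ together with distinguished solutions $f_{k,h_k}$ satisfy the Standing Assumption described in the context. Suppose that there are constants $\alpha_j\in\mathbb{R}$, $0\le j<N+1$, such that $T_jf=\alpha_j f$ holds for all $0\le j<N+1$ whenever $f$ is a distinguished solution. Let $0\le n<N+1$, let $h\in C_b^n(\mathbb{R})$ with $\mu_0(h)=0$, and write $f:=f_{0,h}$. Put $a_j:=\big|\sum_{i=0}^j\alpha_i\big|$ for $0\le j<N+1$. (i) If there exist constants $C_l$, $0\le l<N+1$, such that $\|f_{l,h_l}\|\le C_l\|h_l\|$ for each $0\le l<N+1$ and each $h_l$ with $\mu_l(h_l)=0$, then $$\|f^{(n)}\|\le C_n\sum_{j=0}^n\Big(\prod_{i=j}^{n-1}C_ia_i\Big)\|h^{(j)}\|.$$ (ii) If there exist constants $D_l$, $0\le l<N+1$, such that $\|f_{l,h_l}'\|\le D_l\|h_l\|$ for each $0\le l<N+1$ and each $h_l$ with $\mu_l(h_l)=0$, then, if $n=2k+1$, $$\|f^{(2k+1)}\|\le D_{2k}\sum_{j=0}^k\Big(\prod_{i=j}^{k-1}D_{2i}a_{2i+1}\Big)\|h^{(2j)}\|,$$ and, if $n=2k$, $$\|f^{(2k)}\|\le D_{2k-1}\sum_{j=1}^k\Big(\prod_{i=j}^{k-1}D_{2i-1}a_{2i}\Big)\|h^{(2j-1)}\|+\|f\|\prod_{i=1}^kD_{2i-1}a_{2i-2}.$$ (iii) If $1\le n<N+1$ and there exist constants $E_l$, $0\le l<N+1$,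 such that $\|f_{l,h_l}'\|\le E_l\|h_l'\|$ for each $0\le l<N+1$ and each Lipschitz-continuous $h_l$ with $\mu_l(h_l)=0$, then $$\|f^{(n)}\|\le E_{n-1}\sum_{j=1}^n\Big(\prod_{i=j}^{n-1}E_{i-1}a_{i-1}\Big)\|h^{(j)}\|.$$
   Context: Notation. $\|\cdot\|$ is the supremum norm. $h\in C_b^n(\mathbb{R})$ means that $h^{(n-1)}$ exists and is absolutely continuous, with derivatives of $h$ up to order $n$ bounded; $h^{(0)}=h$. For a measure $\mu$, $\mu(h)=\int h\,d\mu$; $h$ is centred with respect to $\mu$ if $\mu(h)=0$. Empty products equal $1$ and empty sums (including any prefactor with an undefined negative index, as for $k=0$) equal $0$. Standing Assumption. Fix $N\in\mathbb{N}\cup\{\infty\}$ and an order $p\in\mathbb{N}$. For $0\le k<N+1$ we are given a probability measure $\mu_k$ on $(\mathbb{R},\mathcal{B})$ and linear differential operators $$L_kf(x)=\sum_{j=0}^{p}a_{k,j}(x)f^{(j)}(x),\qquad T_kf(x)=\sum_{j=0}^{p}b_{k,j}(x)f^{(j)}(x),$$ where the leading coefficient $a_{k,p}$ does not depend on $k$ (the coefficient functions $a_{k,j}(x)$ are not to be confused with the constants $a_j$ of the claim). $L_k$ is characterizing for $\mu_k$: a random variable $X$ has law $\mu_k$ if and only if $\mathbb{E}[L_kf(X)]=0$ for all sufficiently smooth $f$. The operators are linked by $$\frac{d}{dx}L_kf(x)=L_{k+1}f'(x)-T_kf(x)\qquad\text{whenever } k+1<N+1.$$ For each $0\le k<N+1$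 and each function $h_k$ with $\mu_k(h_k)=0$ there is a distinguished solution $f_{k,h_k}$ (a fixed, unambiguous choice of solution) of the Stein equation $L_kf=h_k$. Moreover, whenever $k+1<N+1$ (and $h_k$ is differentiable, so that the expression makes sense), the function $h_{k+1}:=h_k'+T_kf_{k,h_k}$ is integrable and centred with respect to $\mu_{k+1}$, and $f_{k,h_k}'$, which solves $L_{k+1}f=h_{k+1}$, is the distinguished solution of that equation: $f_{k,h_k}'=f_{k+1,h_{k+1}}$. *)

theory Defs
  imports "HOL-Probability.Probability"
begin

definition sup_norm :: "(real \<Rightarrow> real) \<Rightarrow> ereal" where
  "sup_norm g = (SUP x. ereal \<bar>g x\<bar>)"

text \<open>Derivatives are total functions, extended by 0 to the points where the derivative does not
  exist. Thus the sup norm of a derivative that exists only almost everywhere is the supremum over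
  the points where it exists, which for an absolutely continuous function is also the essential
  supremum and the best Lipschitz constant.\<close>

definition ext_deriv :: "(real \<Rightarrow> real) \<Rightarrow> real \<Rightarrow> real" where
  "ext_deriv g x = (if g field_differentiable at x then deriv g x else 0)"

abbreviation nderiv :: "nat \<Rightarrow> (real \<Rightarrow> real) \<Rightarrow> real \<Rightarrow> real" where
  "nderiv n \<equiv> ext_deriv ^^ n"

definition abs_cont_on :: "real \<Rightarrow> real \<Rightarrow> (real \<Rightarrow> real) \<Rightarrow> bool" where
  "abs_cont_on s t g \<longleftrightarrow>
     (\<forall>e>0. \<exists>d>0. \<forall>I :: (real \<times> real) set.
        finite I \<and> (\<forall>(u, v)\<in>I. s \<le> u \<and> u \<le> v \<and> v \<le> t) \<and>
        pairwise (\<lambda>P Q. {fst P<..<snd P} \<inter> {fst Q<..<snd Q} = {}) I \<and>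
        (\<Sum>(u, v)\<in>I. v - u) < d
        \<longrightarrow> (\<Sum>(u, v)\<in>I. \<bar>g v - g u\<bar>) < e)"

text \<open>Absolute continuity on every compact interval; for functions on the line with bounded
  derivative this is the same as global absolute continuity. By Lebesgue's theorem the second
  conjunct follows from the first. It is kept because it is what gives the derivative a meaning.\<close>

definition ac_differentiable :: "(real \<Rightarrow> real) \<Rightarrow> bool" where
  "ac_differentiable g \<longleftrightarrow>
     (\<forall>s t. abs_cont_on s t g) \<and> (AE x in lborel. g field_differentiable at x)"

text \<open>The derivative of order n - 1 exists everywhere and is absolutely continuous, so that the one
  of order n exists almost everywhere (no condition if n = 0).\<close>

definition has_derivs :: "nat \<Rightarrow> (real \<Rightarrow> real) \<Rightarrow> bool" where
  "has_derivs n g \<longleftrightarrow>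
     (\<forall>m x. Suc m < n \<longrightarrow> nderiv m g field_differentiable at x) \<and>
     (1 \<le> n \<longrightarrow> ac_differentiable (nderiv (n - 1) g))"

definition Cb :: "nat \<Rightarrow> (real \<Rightarrow> real) set" where
  "Cb n = {h. has_derivs n h \<and> (\<forall>m\<le>n. bounded (range (nderiv m h)))}"

definition centred :: "real measure \<Rightarrow> (real \<Rightarrow> real) \<Rightarrow> bool" where
  "centred \<mu> h \<longleftrightarrow> integrable \<mu> h \<and> (\<integral>x. h x \<partial>\<mu>) = 0"

definition diff_op :: "nat \<Rightarrow> (nat \<Rightarrow> real \<Rightarrow> real) \<Rightarrow> (real \<Rightarrow> real) \<Rightarrow> real \<Rightarrow> real" where
  "diff_op p c f x = (\<Sum>j\<le>p. c j x * nderiv j f x)"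

definition test_functions :: "(real \<Rightarrow> real) set" where
  "test_functions =
     {f. (\<forall>m x. nderiv m f field_differentiable at x) \<and> (\<exists>r. \<forall>x. \<bar>x\<bar> > r \<longrightarrow> f x = 0)}"

text \<open>The class F of sufficiently smooth functions is left open between the smooth functions with
  compact support and the p times differentiable functions. The law of the random variable is
  represented by the probability measure \<nu>.\<close>

definition characterizing ::
  "nat \<Rightarrow> (nat \<Rightarrow> real \<Rightarrow> real) \<Rightarrow> real measure \<Rightarrow> bool" where
  "characterizing p c \<mu> \<longleftrightarrow>
     (\<exists>F. test_functions \<subseteq> F \<and> (\<forall>f\<in>F. \<forall>m<p. \<forall>x. nderiv m f field_differentiable at x) \<and>
        (\<forall>\<nu>. prob_space \<nu> \<and> sets \<nu> = sets borel \<longrightarrow>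
           (\<nu> = \<mu> \<longleftrightarrow>
              (\<forall>f\<in>F. integrable \<nu> (diff_op p c f) \<and> (\<integral>x. diff_op p c f x \<partial>\<nu>) = 0))))"

text \<open>For a right-hand side that is merely measurable, the derivative of order p and hence the
  equation only make sense almost everywhere. No continuity of the lower derivatives is demanded,
  since the leading coefficient may have zeros.\<close>

definition solves ::
  "nat \<Rightarrow> (nat \<Rightarrow> real \<Rightarrow> real) \<Rightarrow> (real \<Rightarrow> real) \<Rightarrow> (real \<Rightarrow> real) \<Rightarrow> bool" where
  "solves p c h f \<longleftrightarrow>
     (AE x in lborel. (\<forall>m<p. nderiv m f field_differentiable at x) \<and> diff_op p c f x = h x)"

text \<open>The coefficients of the operators L k and T k are a k j and b k j, and sol k h is the
  distinguished solution of the k-th Stein equation with right-hand side h (relevant only for h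
  centred with respect to \<mu> k). In the last assumption h is differentiable in the sense of absolute
  continuity, as required for applications to Cb n. The expression h' + T k f is then defined only
  almost everywhere, and the assumption is made for each Borel function g representing it.\<close>

locale stein_hierarchy =
  fixes N :: enat and p :: nat
    and \<mu> :: "nat \<Rightarrow> real measure"
    and a b :: "nat \<Rightarrow> nat \<Rightarrow> real \<Rightarrow> real"
    and sol :: "nat \<Rightarrow> (real \<Rightarrow> real) \<Rightarrow> real \<Rightarrow> real"
  assumes prob: "\<And>k. enat k < N + 1 \<Longrightarrow> prob_space (\<mu> k) \<and> sets (\<mu> k) = sets borel"
    and leading: "\<And>k l. enat k < N + 1 \<Longrightarrow> enat l < N + 1 \<Longrightarrow> a k p = a l p"
    and characterizing: "\<And>k. enat k < N + 1 \<Longrightarrow> characterizing p (a k) (\<mu> k)"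
    and linked: "\<And>k f x. enat (k + 1) < N + 1 \<Longrightarrow>
       (\<And>m y. m \<le> p \<Longrightarrow> nderiv m f field_differentiable at y) \<Longrightarrow>
       (diff_op p (a k) f has_real_derivative
          diff_op p (a (k + 1)) (ext_deriv f) x - diff_op p (b k) f x) (at x)"
    and solution: "\<And>k h. enat k < N + 1 \<Longrightarrow> centred (\<mu> k) h \<Longrightarrow> solves p (a k) h (sol k h)"
    and derivative_of_solution: "\<And>k h g. enat (k + 1) < N + 1 \<Longrightarrow> centred (\<mu> k) h \<Longrightarrow>
       ac_differentiable h \<Longrightarrow> g \<in> borel_measurable borel \<Longrightarrow>
       (AE x in lborel. g x = ext_deriv h x + diff_op p (b k) (sol k h) x) \<Longrightarrow>
       centred (\<mu> (k + 1)) g \<and> ac_differentiable (sol k h) \<and>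
       (AE x in lborel. ext_deriv (sol k h) x = sol (k + 1) g x)"

end

theory Submission
  imports Defs
begin

text \<open>Write f for the solution with right-hand side h. Differentiating the Stein equation k times
  shows that the k-th derivative of f is the distinguished solution of the k-th equation with
  right-hand side the k-th derivative of h plus (\<alpha> 0 + ... + \<alpha> (k - 1)) times the (k - 1)-st
  derivative of f. Applying the assumed bound to this solution gives a linear recursion for the sup
  norms of the derivatives of f: with step 1 in (i) and (iii), with step 2 in (ii). Unrolling it
  gives the three estimates.

  Since the hypotheses identify derivatives only almost everywhere while sup norms are taken
  pointwise, the analytic core is that an absolutely continuous function whose derivative is almost
  everywhere within M of c has increments within M (t - s) of c (t - s). Hence almost everywhere
  bounds on the derivative are bounds everywhere, and an almost everywhere derivative with a
  continuous version is a derivative everywhere. The constants in the hypotheses are nonnegative,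
  as one sees from the right-hand side sin minus its mean.\<close>

subsection \<open>Absolutely continuous functions\<close>

text \<open>Proof by a fine tagged division: tags at good points contribute at most M + e times the
  length, while the intervals tagged in the null set lie in an open set of small measure, so that
  absolute continuity controls their contribution.\<close>

lemma abs_cont_on_increment_bound:
  assumes ac: "abs_cont_on s t g" and "s \<le> t" and M: "0 \<le> M"
    and ae: "AE x in lborel. s \<le> x \<and> x \<le> t \<longrightarrow>
       g field_differentiable at x \<and> \<bar>deriv g x - c\<bar> \<le> M"
  shows "\<bar>g t - g s - c * (t - s)\<bar> \<le> M * (t - s)"
proof (rule field_le_epsilon)
  fix e0 :: real assume "0 < e0"
  \<comment> \<open>The final error is \<open>e * (t - s)\<close> from the good tags plus
    \<open>e + \<bar>c\<bar> * e\<close> from the bad ones; with this \<open>e\<close> it adds up to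
    exactly \<open>e0\<close>.\<close>
  define e where "e = e0 / (t - s + 1 + \<bar>c\<bar>)"
  have e: "0 < e" unfolding e_def using \<open>0 < e0\<close> \<open>s \<le> t\<close> by (intro divide_pos_pos) auto
  from ac[unfolded abs_cont_on_def, rule_format, OF e] obtain d0 where d0: "d0 > 0" and
    D0: "\<And>I :: (real \<times> real) set. finite I \<Longrightarrow> (\<forall>(u, v)\<in>I. s \<le> u \<and> u \<le> v \<and> v \<le> t) \<Longrightarrow>
        pairwise (\<lambda>P Q. {fst P<..<snd P} \<inter> {fst Q<..<snd Q} = {}) I \<Longrightarrow>
        (\<Sum>(u, v)\<in>I. v - u) < d0 \<Longrightarrow> (\<Sum>(u, v)\<in>I. \<bar>g v - g u\<bar>) < e"
    by blast
  \<comment> \<open>\<open>d \<le> d0\<close> makes absolute continuity applicable to the intervals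
    tagged in \<open>Z\<close>, and \<open>d \<le> e\<close> controls the linear term
    \<open>c * y\<close> on them.\<close>
  define d where "d = min d0 e"
  have d: "d > 0" "d \<le> d0" "d \<le> e" using d0 e by (auto simp: d_def)
  obtain Z where Z: "\<And>x. x \<notin> Z \<Longrightarrow> s \<le> x \<and> x \<le> t \<longrightarrow>
       g field_differentiable at x \<and> \<bar>deriv g x - c\<bar> \<le> M" and Z0: "Z \<in> null_sets lborel"
    using ae by (rule AE_E3) auto
  obtain U where U: "open U" "Z \<subseteq> U" "emeasure lborel (U - Z) < d"
  proof (rule outer_regular_lborel)
    show "Z \<in> sets borel" using Z0 by auto
  qed (use d in auto)
  have "emeasure lborel U = emeasure lborel (U - Z)"
    using Z0 U(1) by (simp add: emeasure_Diff_null_set)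
  with U(3) have Ud: "emeasure lborel U < ennreal d" by simp
  have "\<exists>r>0. \<forall>y. \<bar>y - x\<bar> < r \<longrightarrow> \<bar>g y - g x - deriv g x * (y - x)\<bar> \<le> e * \<bar>y - x\<bar>"
    if "x \<notin> Z" "s \<le> x" "x \<le> t" for x
  proof -
    have "(g has_field_derivative deriv g x) (at x)"
      using Z[OF that(1)] that by (auto simp: field_differentiable_derivI)
    then have "(g has_derivative (\<lambda>h. deriv g x * h)) (at x)"
      by (simp add: has_field_derivative_def)
    from this[unfolded has_derivative_at_alt] e show ?thesis
      by (auto simp: mult.commute)
  qed
  then obtain r where r: "\<And>x. x \<notin> Z \<Longrightarrow> s \<le> x \<Longrightarrow> x \<le> t \<Longrightarrow> r x > 0" and
    R: "\<And>x y. x \<notin> Z \<Longrightarrow> s \<le> x \<Longrightarrow> x \<le> t \<Longrightarrow> \<bar>y - x\<bar> < r x \<Longrightarrow>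
       \<bar>g y - g x - deriv g x * (y - x)\<bar> \<le> e * \<bar>y - x\<bar>"
    by metis
  \<comment> \<open>A tag in \<open>Z\<close> forces its interval into \<open>U\<close>; any other
    tag in \<open>{s..t}\<close> forces it into the ball on which the linear approximation of
    \<open>g\<close> at the tag is good.\<close>
  define \<gamma> where "\<gamma> x = (if x \<in> Z then U else if s \<le> x \<and> x \<le> t then ball x (r x) else UNIV)" for x
  have "gauge \<gamma>" unfolding gauge_def \<gamma>_def using U r by auto
  then obtain p where p: "p tagged_division_of {s..t}" "\<gamma> fine p"
    by (rule fine_division_exists_real)
  note pD = tagged_division_ofD[OF p(1)]
  have K: "Inf K \<le> x \<and> x \<le> Sup K \<and> K = {Inf K..Sup K} \<and> s \<le> Inf K \<and> Sup K \<le> t"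
    if xK: "(x, K) \<in> p" for x K
  proof -
    obtain u v where "K = cbox u v" using pD(4)[OF xK] by blast
    then have K: "K = {u..v}" by simp
    moreover have "x \<in> K" "K \<subseteq> {s..t}" using pD(2,3)[OF xK] by auto
    ultimately show ?thesis by auto
  qed
  define \<phi> where "\<phi> y = g y - c * y" for y
  have tele: "(\<Sum>(x, K)\<in>p. \<phi> (Sup K) - \<phi> (Inf K)) = \<phi> t - \<phi> s"
    by (rule additive_tagged_division_1[OF \<open>s \<le> t\<close> p(1)])
  have len: "(\<Sum>(x, K)\<in>p. Sup K - Inf K) = t - s"
    using additive_tagged_division_1[OF \<open>s \<le> t\<close> p(1), of "\<lambda>y. y"] by simp
  define B where "B = {(x, K) \<in> p. x \<in> Z}"
  have Bp: "B \<subseteq> p" "finite B" using pD(1) by (auto simp: B_def intro: finite_subset)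
  \<comment> \<open>Absolute continuity speaks of a set of endpoint pairs, so distinct members of
    \<open>B\<close> must not collapse to the same pair. One interval with two different tags would
    have empty interior, hence be a single point, and that point is its only possible tag.\<close>
  have inj: "inj_on (\<lambda>(x, K). (Inf K, Sup K)) B"
  proof (rule inj_onI, clarify)
    fix x1 K1 x2 K2 assume a: "(x1, K1) \<in> B" "(x2, K2) \<in> B" "Inf K1 = Inf K2" "Sup K1 = Sup K2"
    then have m: "(x1, K1) \<in> p" "(x2, K2) \<in> p" using Bp by auto
    have "K1 = K2" using K[OF m(1)] K[OF m(2)] a by metis
    moreover have "x1 = x2"
    proof (rule ccontr)
      assume "x1 \<noteq> x2"
      then have "interior K1 = {}" using pD(5)[OF m] \<open>K1 = K2\<close> by auto
      then have "{Inf K1<..<Sup K1} = {}" using K[OF m(1)] by (metis interior_atLeastAtMost_real)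
      then have "Sup K1 \<le> Inf K1" by auto
      with K[OF m(1)] K[OF m(2)] \<open>K1 = K2\<close> \<open>x1 \<noteq> x2\<close> show False by auto
    qed
    ultimately show "x1 = x2 \<and> K1 = K2" by simp
  qed
  define I where "I = (\<lambda>(x, K). (Inf K, Sup K)) ` B"
  have sI: "(\<Sum>(u, v)\<in>I. F u v) = (\<Sum>(x, K)\<in>B. F (Inf K) (Sup K))"
    for F :: "real \<Rightarrow> real \<Rightarrow> real"
    unfolding I_def by (subst sum.reindex[OF inj]) (simp add: case_prod_unfold)
  have Iord: "\<forall>(u, v)\<in>I. s \<le> u \<and> u \<le> v \<and> v \<le> t"
    unfolding I_def using K Bp by fastforce
  have Idisj: "pairwise (\<lambda>P Q. {fst P<..<snd P} \<inter> {fst Q<..<snd Q} = {}) I"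
  proof (rule pairwiseI)
    fix P Q assume a: "P \<in> I" "Q \<in> I" "P \<noteq> Q"
    then obtain x1 K1 x2 K2 where b: "(x1, K1) \<in> B" "(x2, K2) \<in> B" "P = (Inf K1, Sup K1)"
      "Q = (Inf K2, Sup K2)" by (auto simp: I_def)
    then have m: "(x1, K1) \<in> p" "(x2, K2) \<in> p" using Bp by auto
    have "interior K1 \<inter> interior K2 = {}" using pD(5)[OF m] a b by auto
    then show "{fst P<..<snd P} \<inter> {fst Q<..<snd Q} = {}"
      using K[OF m(1)] K[OF m(2)] b by (metis fst_conv snd_conv interior_atLeastAtMost_real)
  qed
  have finI: "finite I" using Bp by (simp add: I_def)
  \<comment> \<open>The total length of the bad intervals is the measure of a disjoint union of open
    intervals contained in \<open>U\<close>.\<close>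
  have "ennreal (\<Sum>(u, v)\<in>I. v - u) = (\<Sum>P\<in>I. ennreal (snd P - fst P))"
    using Iord by (subst sum_ennreal) (auto simp: case_prod_unfold)
  also have "\<dots> = (\<Sum>P\<in>I. emeasure lborel {fst P<..<snd P})"
    using Iord by (intro sum.cong) auto
  also have "\<dots> = emeasure lborel (\<Union>P\<in>I. {fst P<..<snd P})"
    using finI Idisj by (intro sum_emeasure) (auto simp: disjoint_family_on_def pairwise_def)
  also have "\<dots> \<le> emeasure lborel U"
  proof (rule emeasure_mono)
    show "(\<Union>P\<in>I. {fst P<..<snd P}) \<subseteq> U"
    proof
      fix y assume "y \<in> (\<Union>P\<in>I. {fst P<..<snd P})"
      then obtain x K' where b: "(x, K') \<in> p" "x \<in> Z" "y \<in> {Inf K'..Sup K'}"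
        by (force simp: I_def B_def)
      then have "K' \<subseteq> U" using fineD[OF p(2) b(1)] by (simp add: \<gamma>_def)
      then show "y \<in> U" using b K[OF b(1)] by auto
    qed
  qed (use U in auto)
  also have "\<dots> < ennreal d" by (rule Ud)
  finally have small: "(\<Sum>(u, v)\<in>I. v - u) < d"
    using d Iord by (subst (asm) ennreal_less_iff) (auto intro!: sum_nonneg)
  have bad_g: "(\<Sum>(u, v)\<in>I. \<bar>g v - g u\<bar>) < e"
    using small d by (intro D0[OF finI Iord Idisj]) auto
  have "\<bar>\<Sum>(x, K)\<in>B. \<phi> (Sup K) - \<phi> (Inf K)\<bar> \<le> (\<Sum>(x, K)\<in>B. \<bar>\<phi> (Sup K) - \<phi> (Inf K)\<bar>)"
    by (simp add: case_prod_unfold sum_abs)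
  also have "\<dots> = (\<Sum>(u, v)\<in>I. \<bar>\<phi> v - \<phi> u\<bar>)"
    by (simp add: sI[of "\<lambda>u v. \<bar>\<phi> v - \<phi> u\<bar>"])
  also have "\<dots> \<le> (\<Sum>(u, v)\<in>I. \<bar>g v - g u\<bar> + \<bar>c\<bar> * (v - u))"
  proof (rule sum_mono, clarify)
    fix u v assume "(u, v) \<in> I"
    then have "u \<le> v" using Iord by auto
    then have "\<bar>c * (v - u)\<bar> = \<bar>c\<bar> * (v - u)" by (simp add: abs_mult)
    then show "\<bar>\<phi> v - \<phi> u\<bar> \<le> \<bar>g v - g u\<bar> + \<bar>c\<bar> * (v - u)"
      unfolding \<phi>_def right_diff_distrib by linarith
  qed
  also have "\<dots> = (\<Sum>(u, v)\<in>I. \<bar>g v - g u\<bar>) + \<bar>c\<bar> * (\<Sum>(u, v)\<in>I. v - u)"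
    by (simp add: case_prod_unfold sum.distrib sum_distrib_left)
  also have "\<dots> \<le> e + \<bar>c\<bar> * e"
    using bad_g small d by (intro add_mono mult_left_mono) auto
  finally have bad: "\<bar>\<Sum>(x, K)\<in>B. \<phi> (Sup K) - \<phi> (Inf K)\<bar> \<le> e + \<bar>c\<bar> * e" .
  have good1: "\<bar>\<phi> (Sup K) - \<phi> (Inf K)\<bar> \<le> (M + e) * (Sup K - Inf K)" if m: "(x, K) \<in> p - B" for x K
  proof -
    have mp: "(x, K) \<in> p" and xZ: "x \<notin> Z" using m by (auto simp: B_def)
    note k = K[OF mp]
    have xst: "s \<le> x" "x \<le> t" using k by auto
    have "K \<subseteq> ball x (r x)" using fineD[OF p(2) mp] xZ xst by (simp add: \<gamma>_def)
    moreover have "Inf K \<in> K" "Sup K \<in> K" using k by (metis atLeastAtMost_iff order_trans order_refl)+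
    ultimately have "\<bar>Inf K - x\<bar> < r x" "\<bar>Sup K - x\<bar> < r x" by (auto simp: dist_real_def)
    note R' = R[OF xZ xst this(1)] R[OF xZ xst this(2)]
    \<comment> \<open>The tag lies between the endpoints, so the errors on its two sides add up to
      at most \<open>e\<close> times the full length.\<close>
    have "\<bar>g (Sup K) - g (Inf K) - deriv g x * (Sup K - Inf K)\<bar> \<le> e * (Sup K - Inf K)"
    proof -
      have "\<bar>Inf K - x\<bar> = x - Inf K" "\<bar>Sup K - x\<bar> = Sup K - x" using k by auto
      with R' show ?thesis unfolding right_diff_distrib by (simp add: right_diff_distrib)
    qed
    moreover have "\<bar>(deriv g x - c) * (Sup K - Inf K)\<bar> \<le> M * (Sup K - Inf K)"
      using Z[OF xZ] xst k by (auto simp: abs_mult intro!: mult_right_mono)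
    moreover have "\<phi> (Sup K) - \<phi> (Inf K) =
        (g (Sup K) - g (Inf K) - deriv g x * (Sup K - Inf K)) + (deriv g x - c) * (Sup K - Inf K)"
      by (simp add: \<phi>_def algebra_simps)
    ultimately show ?thesis unfolding distrib_right by linarith
  qed
  have "\<bar>\<Sum>(x, K)\<in>p - B. \<phi> (Sup K) - \<phi> (Inf K)\<bar> \<le> (\<Sum>(x, K)\<in>p - B. \<bar>\<phi> (Sup K) - \<phi> (Inf K)\<bar>)"
    by (simp add: case_prod_unfold sum_abs)
  also have "\<dots> \<le> (\<Sum>(x, K)\<in>p - B. (M + e) * (Sup K - Inf K))"
    using good1 by (intro sum_mono) auto
  also have "\<dots> \<le> (\<Sum>(x, K)\<in>p. (M + e) * (Sup K - Inf K))"
    using pD(1) M e K by (intro sum_mono2) (force intro!: mult_nonneg_nonneg)+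
  also have "\<dots> = (M + e) * (t - s)"
    unfolding len[symmetric] by (simp add: sum_distrib_left case_prod_unfold)
  finally have good: "\<bar>\<Sum>(x, K)\<in>p - B. \<phi> (Sup K) - \<phi> (Inf K)\<bar> \<le> (M + e) * (t - s)" .
  have "\<phi> t - \<phi> s = (\<Sum>(x, K)\<in>p - B. \<phi> (Sup K) - \<phi> (Inf K)) + (\<Sum>(x, K)\<in>B. \<phi> (Sup K) - \<phi> (Inf K))"
    unfolding tele[symmetric] using sum.subset_diff[OF Bp(1) pD(1)] .
  with good bad have "\<bar>\<phi> t - \<phi> s\<bar> \<le> (M + e) * (t - s) + (e + \<bar>c\<bar> * e)" by linarith
  also have "\<dots> = M * (t - s) + e * (t - s + 1 + \<bar>c\<bar>)" by (simp add: algebra_simps)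
  also have "e * (t - s + 1 + \<bar>c\<bar>) = e0" unfolding e_def using \<open>s \<le> t\<close> by simp
  finally show "\<bar>g t - g s - c * (t - s)\<bar> \<le> M * (t - s) + e0"
    by (simp add: \<phi>_def algebra_simps)
qed

section \<open>Lipschitz bounds and pointwise derivatives from almost everywhere information\<close>

lemma ext_deriv_eqI: "(g has_real_derivative d) (at x) \<Longrightarrow> ext_deriv g x = d"
  by (auto simp: ext_deriv_def field_differentiable_def DERIV_imp_deriv)

lemma has_real_derivative_ext_deriv:
  "g field_differentiable at x \<Longrightarrow> (g has_real_derivative ext_deriv g x) (at x)"
  by (simp add: ext_deriv_def field_differentiable_derivI)

lemma lipschitz_imp_abs_cont_on:
  assumes "L-lipschitz_on UNIV g"
  shows "abs_cont_on s t g"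
  unfolding abs_cont_on_def
proof (intro allI impI)
  fix e :: real assume "0 < e"
  have L: "0 \<le> L" using assms lipschitz_on_nonneg by blast
  show "\<exists>d>0. \<forall>I. finite I \<and> (\<forall>(u, v)\<in>I. s \<le> u \<and> u \<le> v \<and> v \<le> t) \<and>
      pairwise (\<lambda>P Q. {fst P<..<snd P} \<inter> {fst Q<..<snd Q} = {}) I \<and>
      (\<Sum>(u, v)\<in>I. v - u) < d \<longrightarrow> (\<Sum>(u, v)\<in>I. \<bar>g v - g u\<bar>) < e"
  proof (intro exI[of _ "e / (L + 1)"] conjI allI impI)
    show "0 < e / (L + 1)" using \<open>0 < e\<close> L by simp
    fix I :: "(real \<times> real) set"
    assume I: "finite I \<and> (\<forall>(u, v)\<in>I. s \<le> u \<and> u \<le> v \<and> v \<le> t) \<and>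
      pairwise (\<lambda>P Q. {fst P<..<snd P} \<inter> {fst Q<..<snd Q} = {}) I \<and>
      (\<Sum>(u, v)\<in>I. v - u) < e / (L + 1)"
    have "(\<Sum>(u, v)\<in>I. \<bar>g v - g u\<bar>) \<le> (\<Sum>(u, v)\<in>I. (L + 1) * (v - u))"
    proof (rule sum_mono, clarify)
      fix u v assume "(u, v) \<in> I"
      then have "u \<le> v" using I by auto
      then have "\<bar>g v - g u\<bar> \<le> L * (v - u)"
        using lipschitz_onD[OF assms, of v u] by (simp add: dist_real_def)
      also have "\<dots> \<le> (L + 1) * (v - u)" using \<open>u \<le> v\<close> by (intro mult_right_mono) auto
      finally show "\<bar>g v - g u\<bar> \<le> (L + 1) * (v - u)" .
    qed
    also have "\<dots> = (L + 1) * (\<Sum>(u, v)\<in>I. v - u)"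
      by (simp add: sum_distrib_left case_prod_unfold)
    also have "\<dots> < e" using I L by (simp add: pos_less_divide_eq mult.commute)
    finally show "(\<Sum>(u, v)\<in>I. \<bar>g v - g u\<bar>) < e" .
  qed
qed

lemma abs_cont_on_add_cmult:
  assumes "abs_cont_on s t u" "abs_cont_on s t v"
  shows "abs_cont_on s t (\<lambda>x. u x + c * v x)"
  unfolding abs_cont_on_def
proof (intro allI impI)
  fix e :: real assume e: "0 < e"
  define e' where "e' = e / (2 * (\<bar>c\<bar> + 1))"
  have e': "e' > 0" "\<bar>c\<bar> * e' \<le> e / 2" using e by (auto simp: e'_def field_simps)
  have "e / 2 > 0" using e by simp
  from assms(1)[unfolded abs_cont_on_def, rule_format, OF this]
  obtain d1 where d1: "d1 > 0" "\<And>I :: (real \<times> real) set. finite I \<and> (\<forall>(u, v)\<in>I. s \<le> u \<and> u \<le> v \<and> v \<le> t) \<and>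
      pairwise (\<lambda>P Q. {fst P<..<snd P} \<inter> {fst Q<..<snd Q} = {}) I \<and>
      (\<Sum>(u, v)\<in>I. v - u) < d1 \<Longrightarrow> (\<Sum>(y, z)\<in>I. \<bar>u z - u y\<bar>) < e / 2" by blast
  from assms(2)[unfolded abs_cont_on_def, rule_format, OF e'(1)]
  obtain d2 where d2: "d2 > 0" "\<And>I :: (real \<times> real) set. finite I \<and> (\<forall>(u, v)\<in>I. s \<le> u \<and> u \<le> v \<and> v \<le> t) \<and>
      pairwise (\<lambda>P Q. {fst P<..<snd P} \<inter> {fst Q<..<snd Q} = {}) I \<and>
      (\<Sum>(u, v)\<in>I. v - u) < d2 \<Longrightarrow> (\<Sum>(y, z)\<in>I. \<bar>v z - v y\<bar>) < e'" by blast
  show "\<exists>d>0. \<forall>I. finite I \<and> (\<forall>(u, v)\<in>I. s \<le> u \<and> u \<le> v \<and> v \<le> t) \<and>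
      pairwise (\<lambda>P Q. {fst P<..<snd P} \<inter> {fst Q<..<snd Q} = {}) I \<and>
      (\<Sum>(u, v)\<in>I. v - u) < d \<longrightarrow>
      (\<Sum>(y, z)\<in>I. \<bar>u z + c * v z - (u y + c * v y)\<bar>) < e"
  proof (intro exI[of _ "min d1 d2"] conjI allI impI)
    fix I :: "(real \<times> real) set"
    assume I: "finite I \<and> (\<forall>(u, v)\<in>I. s \<le> u \<and> u \<le> v \<and> v \<le> t) \<and>
      pairwise (\<lambda>P Q. {fst P<..<snd P} \<inter> {fst Q<..<snd Q} = {}) I \<and>
      (\<Sum>(u, v)\<in>I. v - u) < min d1 d2"
    have "(\<Sum>(y, z)\<in>I. \<bar>u z + c * v z - (u y + c * v y)\<bar>)
        \<le> (\<Sum>(y, z)\<in>I. \<bar>u z - u y\<bar> + \<bar>c\<bar> * \<bar>v z - v y\<bar>)"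
    proof (rule sum_mono, clarify)
      fix y z :: real
      have "u z + c * v z - (u y + c * v y) = (u z - u y) + c * (v z - v y)"
        by (simp add: algebra_simps)
      then show "\<bar>u z + c * v z - (u y + c * v y)\<bar> \<le> \<bar>u z - u y\<bar> + \<bar>c\<bar> * \<bar>v z - v y\<bar>"
        using abs_triangle_ineq[of "u z - u y" "c * (v z - v y)"] by (simp add: abs_mult)
    qed
    also have "\<dots> = (\<Sum>(y, z)\<in>I. \<bar>u z - u y\<bar>) + \<bar>c\<bar> * (\<Sum>(y, z)\<in>I. \<bar>v z - v y\<bar>)"
      by (simp add: sum.distrib sum_distrib_left case_prod_unfold)
    also have "\<dots> \<le> (\<Sum>(y, z)\<in>I. \<bar>u z - u y\<bar>) + \<bar>c\<bar> * e'"
      using d2(2)[of I] I by (intro add_left_mono mult_left_mono) auto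
    also have "\<dots> < e / 2 + e / 2"
      using d1(2)[of I] I e' by (intro add_less_le_mono) auto
    finally show "(\<Sum>(y, z)\<in>I. \<bar>u z + c * v z - (u y + c * v y)\<bar>) < e" by simp
  qed (use d1 d2 in auto)
qed

lemma ac_differentiable_add_cmult:
  assumes "ac_differentiable u" "ac_differentiable v"
  shows "ac_differentiable (\<lambda>x. u x + c * v x)"
proof -
  have "AE x in lborel. u field_differentiable at x" "AE x in lborel. v field_differentiable at x"
    using assms by (auto simp: ac_differentiable_def)
  then have "AE x in lborel. (\<lambda>x. u x + c * v x) field_differentiable at x"
    by eventually_elim
      (intro field_differentiable_add field_differentiable_mult field_differentiable_const)
  then show ?thesis
    using assms by (auto simp: ac_differentiable_def intro: abs_cont_on_add_cmult)
qed

lemma ac_differentiable_imp_continuous: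
  assumes "ac_differentiable g"
  shows "continuous_on UNIV g"
proof -
  have "\<exists>d>0. \<forall>y. \<bar>y - x\<bar> < d \<longrightarrow> \<bar>g y - g x\<bar> < e" if "0 < e" for x e :: real
  proof -
    have "abs_cont_on (x - 1) (x + 1) g" using assms by (auto simp: ac_differentiable_def)
    from this[unfolded abs_cont_on_def, rule_format, OF that]
    obtain d where d: "d > 0" "\<And>I :: (real \<times> real) set. finite I \<and> (\<forall>(u, v)\<in>I. x - 1 \<le> u \<and> u \<le> v \<and> v \<le> x + 1) \<and>
      pairwise (\<lambda>P Q. {fst P<..<snd P} \<inter> {fst Q<..<snd Q} = {}) I \<and>
      (\<Sum>(u, v)\<in>I. v - u) < d \<Longrightarrow> (\<Sum>(u, v)\<in>I. \<bar>g v - g u\<bar>) < e" by blast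
    \<comment> \<open>A single interval between \<open>x\<close> and \<open>y\<close> is a
      legitimate family; the bound 1 keeps it inside the compact interval.\<close>
    have "\<bar>g y - g x\<bar> < e" if "\<bar>y - x\<bar> < min d 1" for y
      using d(2)[of "{(min x y, max x y)}"] that
      by (auto simp: pairwise_def min_def max_def abs_if split: if_splits)
    with d(1) show ?thesis by (intro exI[of _ "min d 1"]) auto
  qed
  then show ?thesis
    by (auto simp: continuous_on_iff dist_real_def)
qed

text \<open>The increment bound with \<open>c = 0\<close>.\<close>

lemma ac_differentiable_imp_lipschitz:
  assumes "ac_differentiable g" "0 \<le> M" "AE x in lborel. \<bar>ext_deriv g x\<bar> \<le> M"
  shows "M-lipschitz_on UNIV g"
proof (rule lipschitz_onI)
  have *: "\<bar>g y - g x\<bar> \<le> M * (y - x)" if "x \<le> y" for x y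
  proof -
    have "AE z in lborel. g field_differentiable at z"
      using assms(1) by (auto simp: ac_differentiable_def)
    then have "AE z in lborel. x \<le> z \<and> z \<le> y \<longrightarrow> g field_differentiable at z \<and> \<bar>deriv g z - 0\<bar> \<le> M"
      using assms(3) by eventually_elim (auto simp: ext_deriv_def)
    from abs_cont_on_increment_bound[OF _ that assms(2) this] show ?thesis
      using assms(1) by (auto simp: ac_differentiable_def)
  qed
  show "dist (g x) (g y) \<le> M * dist x y" for x y
    using *[of x y] *[of y x] by (cases "x \<le> y") (auto simp: dist_real_def abs_minus_commute)
qed fact

text \<open>Difference quotients are bounded by \<open>M\<close>, and so is their limit; elsewhere
  the default value 0 obeys the bound. Together with the preceding lemma this turns an almost
  everywhere bound on a derivative into one at every point.\<close>

lemma lipschitz_imp_abs_ext_deriv_le: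
  assumes "M-lipschitz_on UNIV g"
  shows "\<bar>ext_deriv g x\<bar> \<le> M"
proof (cases "g field_differentiable at x")
  case True
  have "(\<lambda>h. (g (x + h) - g x) / h) \<midarrow>0\<rightarrow> ext_deriv g x"
    using has_real_derivative_ext_deriv[OF True] by (simp add: DERIV_def)
  then have "(\<lambda>h. \<bar>(g (x + h) - g x) / h\<bar>) \<midarrow>0\<rightarrow> \<bar>ext_deriv g x\<bar>"
    by (rule tendsto_rabs)
  moreover have "\<forall>\<^sub>F h in at 0. \<bar>(g (x + h) - g x) / h\<bar> \<le> M"
  proof -
    have "\<bar>(g (x + h) - g x) / h\<bar> \<le> M" if "h \<noteq> 0" for h
      using lipschitz_onD[OF assms, of "x + h" x] that
      by (simp add: dist_real_def abs_divide pos_divide_le_eq)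
    then show ?thesis by (auto simp: eventually_at intro!: exI[of _ 1])
  qed
  ultimately show ?thesis
    by (intro tendsto_upperbound[where F = "at (0::real)"]) auto
next
  case False
  then show ?thesis using lipschitz_on_nonneg[OF assms] by (simp add: ext_deriv_def)
qed

text \<open>The mean value inequality makes \<open>g\<close> Lipschitz. This covers the derivatives
  of a \<open>Cb\<close> function below the last one.\<close>

lemma differentiable_imp_ac_differentiable:
  assumes "\<And>x. g field_differentiable at x" "bounded (range (ext_deriv g))"
  shows "ac_differentiable g"
proof -
  obtain M where M: "\<And>x. \<bar>ext_deriv g x\<bar> \<le> M"
    using assms(2) by (auto simp: bounded_iff)
  have "M-lipschitz_on UNIV g"
  proof (rule lipschitz_onI)
    show "dist (g x) (g y) \<le> M * dist x y" for x y
      using field_differentiable_bound[of UNIV g "ext_deriv g" M x y] M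
      by (auto simp: dist_real_def has_real_derivative_ext_deriv assms(1))
    show "0 \<le> M" using M[of 0] by linarith
  qed
  then show ?thesis
    using assms(1) by (auto simp: ac_differentiable_def lipschitz_imp_abs_cont_on)
qed

text \<open>Near \<open>x\<close> the almost everywhere derivative stays within \<open>e\<close> of
  \<open>u x\<close>, so the increment bound with \<open>c = u x\<close> and \<open>M = e\<close> is
  the definition of differentiability at \<open>x\<close>.\<close>

lemma ac_differentiable_continuous_derivative:
  assumes "ac_differentiable v" "continuous_on UNIV u" "AE x in lborel. ext_deriv v x = u x"
  shows "(v has_real_derivative u x) (at x)"
proof -
  have "\<exists>d>0. \<forall>y. \<bar>y - x\<bar> < d \<longrightarrow> \<bar>v y - v x - u x * (y - x)\<bar> \<le> e * \<bar>y - x\<bar>" if "e > 0" for e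
  proof -
    note e = that
    have "isCont u x" using assms(2) by (simp add: continuous_on_eq_continuous_at)
    then obtain d where d: "d > 0" "\<And>y. \<bar>y - x\<bar> < d \<Longrightarrow> \<bar>u y - u x\<bar> < e"
      using e by (auto simp: continuous_at_eps_delta dist_real_def)
    have *: "\<bar>v z - v y - u x * (z - y)\<bar> \<le> e * (z - y)"
      if "y \<le> z" "\<bar>y - x\<bar> < d" "\<bar>z - x\<bar> < d" for y z
    proof (rule abs_cont_on_increment_bound[OF _ that(1)])
      have "AE w in lborel. v field_differentiable at w"
        using assms(1) by (auto simp: ac_differentiable_def)
      then show "AE w in lborel. y \<le> w \<and> w \<le> z \<longrightarrow>
          v field_differentiable at w \<and> \<bar>deriv v w - u x\<bar> \<le> e"
        using assms(3)
      proof eventually_elim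
        case (elim w)
        have "\<bar>w - x\<bar> < d" if "y \<le> w" "w \<le> z" using that \<open>\<bar>y - x\<bar> < d\<close> \<open>\<bar>z - x\<bar> < d\<close> by linarith
        with elim d(2)[of w] show ?case by (auto simp: ext_deriv_def)
      qed
    qed (use assms(1) \<open>0 < e\<close> in \<open>auto simp: ac_differentiable_def\<close>)
    have "\<bar>v y - v x - u x * (y - x)\<bar> \<le> e * \<bar>y - x\<bar>" if "\<bar>y - x\<bar> < d" for y
    proof (cases "x \<le> y")
      case True
      then show ?thesis using *[of x y] that d(1) by simp
    next
      case False
      have "\<bar>v y - v x - u x * (y - x)\<bar> = \<bar>v x - v y - u x * (x - y)\<bar>"
        by (subst abs_minus_cancel[symmetric]) (simp add: algebra_simps)
      also have "\<dots> \<le> e * (x - y)" using *[of y x] that d(1) False by simp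
      finally show ?thesis using False by simp
    qed
    with d(1) show ?thesis by blast
  qed
  then have "(v has_derivative (\<lambda>h. u x * h)) (at x)"
    unfolding has_derivative_at_alt by (auto simp: bounded_linear_mult_right)
  then show ?thesis by (simp add: has_field_derivative_def)
qed

subsection \<open>Sup norms and Borel versions\<close>

lemma sup_norm_least: "(\<And>x. ereal \<bar>g x\<bar> \<le> B) \<Longrightarrow> sup_norm g \<le> B"
  unfolding sup_norm_def by (rule SUP_least)

lemma abs_le_sup_norm: "ereal \<bar>g x\<bar> \<le> sup_norm g"
  unfolding sup_norm_def by (rule SUP_upper) simp

lemma sup_norm_nonneg: "0 \<le> sup_norm g"
  using abs_le_sup_norm[of g undefined] by (rule order_trans[rotated]) simp

lemma sup_norm_add_cmult:
  "sup_norm (\<lambda>x. u x + c * v x) \<le> sup_norm u + ereal \<bar>c\<bar> * sup_norm v"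
proof (rule sup_norm_least)
  fix x
  have "ereal \<bar>u x + c * v x\<bar> \<le> ereal \<bar>u x\<bar> + ereal \<bar>c\<bar> * ereal \<bar>v x\<bar>"
    using abs_triangle_ineq[of "u x" "c * v x"] by (simp add: abs_mult)
  also have "\<dots> \<le> sup_norm u + ereal \<bar>c\<bar> * sup_norm v"
    by (intro add_mono ereal_mult_left_mono abs_le_sup_norm) auto
  finally show "ereal \<bar>u x + c * v x\<bar> \<le> sup_norm u + ereal \<bar>c\<bar> * sup_norm v" .
qed

text \<open>An infinite \<open>B\<close> is trivial; a finite one is a Lipschitz constant, which
  bounds the derivative at every point.\<close>

lemma sup_norm_ext_deriv_le_AE:
  assumes "ac_differentiable g" "0 \<le> B" "AE x in lborel. ereal \<bar>ext_deriv g x\<bar> \<le> B"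
  shows "sup_norm (ext_deriv g) \<le> B"
proof (cases B)
  case (real M)
  then have "M-lipschitz_on UNIV g"
    using assms by (intro ac_differentiable_imp_lipschitz) auto
  then show ?thesis
    using real by (auto intro!: sup_norm_least lipschitz_imp_abs_ext_deriv_le)
qed (use assms in auto)

text \<open>The limit of difference quotients along the steps \<open>1 / (n + 1)\<close> is Borel
  and equals the derivative wherever that exists. Such a version is required because the standing
  assumption accepts only Borel right-hand sides.\<close>

lemma ext_deriv_borel_version:
  assumes "ac_differentiable v"
  obtains q where "q \<in> borel_measurable borel" "AE x in lborel. q x = ext_deriv v x"
    "sup_norm q \<le> sup_norm (ext_deriv v)"
proof -
  have v: "v \<in> borel_measurable borel"
    using ac_differentiable_imp_continuous[OF assms] by (rule borel_measurable_continuous_onI)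
  define l where "l x = lim (\<lambda>n. (v (x + inverse (real (Suc n))) - v x) / inverse (real (Suc n)))" for x
  have [measurable]: "l \<in> borel_measurable borel"
    unfolding l_def using v by measurable
  have l: "l x = ext_deriv v x" if "v field_differentiable at x" for x
  proof -
    have "(\<lambda>h. (v (x + h) - v x) / h) \<midarrow>0\<rightarrow> ext_deriv v x"
      using has_real_derivative_ext_deriv[OF that] by (simp add: DERIV_def)
    moreover have "filterlim (\<lambda>n. inverse (real (Suc n))) (at 0) sequentially"
      using LIMSEQ_inverse_real_of_nat by (auto simp: filterlim_at)
    ultimately have "(\<lambda>n. (v (x + inverse (real (Suc n))) - v x) / inverse (real (Suc n)))
        \<longlonglongrightarrow> ext_deriv v x"
      by (rule filterlim_compose)
    then show ?thesis unfolding l_def by (rule limI)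
  qed
  \<comment> \<open>At points of non-differentiability \<open>l\<close> has no controlled value; the
    cut-off keeps the sup norm of the version below that of the derivative.\<close>
  define q where "q x = (if ereal \<bar>l x\<bar> \<le> sup_norm (ext_deriv v) then l x else 0)" for x
  show thesis
  proof
    show "q \<in> borel_measurable borel" unfolding q_def by measurable
    have "AE x in lborel. v field_differentiable at x"
      using assms by (auto simp: ac_differentiable_def)
    then show "AE x in lborel. q x = ext_deriv v x"
      by eventually_elim (auto simp: q_def l abs_le_sup_norm)
    show "sup_norm q \<le> sup_norm (ext_deriv v)"
      by (rule sup_norm_least) (simp add: q_def sup_norm_nonneg flip: zero_ereal_def)
  qed
qed

text \<open>The exceptional null set can be taken Borel, and setting the function to 0 there leaves
  a function continuous on a Borel set.\<close>

lemma AE_continuous_borel_version: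
  fixes f :: "real \<Rightarrow> real"
  assumes "AE x in lborel. isCont f x"
  obtains q where "q \<in> borel_measurable borel" "AE x in lborel. q x = f x"
proof -
  obtain Z where Z: "\<And>x. x \<notin> Z \<Longrightarrow> isCont f x" "Z \<in> null_sets lborel"
    using assms by (rule AE_E3) auto
  show thesis
  proof
    have "Z \<in> sets borel" using Z(2) by auto
    then have "- Z \<in> sets borel" by auto
    moreover have "continuous_on (- Z) f"
      using Z(1) by (intro continuous_at_imp_continuous_on) auto
    ultimately show "(\<lambda>x. indicator (- Z) x *\<^sub>R f x) \<in> borel_measurable borel"
      by (rule borel_measurable_continuous_on_indicator)
    show "AE x in lborel. indicator (- Z) x *\<^sub>R f x = f x"
      using AE_not_in[OF Z(2)] by eventually_elim simp
  qed
qed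

subsection \<open>Linear recursions in the extended reals\<close>

lemma ereal_mult_mult: "ereal a * (ereal b * z) = ereal (a * b) * z"
  by (simp flip: mult.assoc)

text \<open>Unrolls down to \<open>x 0\<close>, which survives as a separate term; this form serves
  even orders in (ii), where \<open>x 0\<close> is the norm of the solution itself. Norms may be
  infinite, and the nonnegativity assumptions justify distributivity in
  \<open>ereal\<close>.\<close>

lemma ereal_linear_recursion_tail:
  fixes x y :: "nat \<Rightarrow> ereal" and c t :: "nat \<Rightarrow> real"
  assumes step: "\<And>k. k < n \<Longrightarrow> x (Suc k) \<le> ereal (c (Suc k)) * (y (Suc k) + ereal (t k) * x k)"
    and c: "\<And>k. k \<le> n \<Longrightarrow> 0 \<le> c k" and t: "\<And>k. 0 \<le> t k"
    and y: "\<And>k. 0 \<le> y k" and x0: "0 \<le> x 0"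
  shows "x n \<le> ereal (c n) * (\<Sum>j=1..n. ereal (\<Prod>i\<in>{j..<n}. c i * t i) * y j)
    + ereal (\<Prod>i=1..n. c i * t (i - 1)) * x 0"
  using step c
proof (induction n)
  case 0
  then show ?case by simp
next
  case (Suc n)
  define S where "S = (\<Sum>j=1..n. ereal (\<Prod>i\<in>{j..<n}. c i * t i) * y j)"
  define P where "P = (\<Prod>i=1..n. c i * t (i - 1))"
  have cn: "0 \<le> c i" if "i \<le> Suc n" for i using Suc.prems(2)[OF that] .
  have S0: "0 \<le> S"
    unfolding S_def using y t cn
    by (auto intro!: sum_nonneg mult_nonneg_nonneg prod_nonneg simp: ereal_zero_le_0_iff)
  have P0: "0 \<le> P" unfolding P_def using t cn by (auto intro!: prod_nonneg mult_nonneg_nonneg)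
  \<comment> \<open>The new summand \<open>j = Suc n\<close> has an empty product; all earlier
    products gain the factor \<open>c n * t n\<close>.\<close>
  have S: "(\<Sum>j=1..Suc n. ereal (\<Prod>i\<in>{j..<Suc n}. c i * t i) * y j) =
      y (Suc n) + ereal (c n * t n) * S"
  proof -
    have "(\<Sum>j=1..n. ereal (\<Prod>i\<in>{j..<Suc n}. c i * t i) * y j) =
        (\<Sum>j=1..n. ereal (c n * t n) * (ereal (\<Prod>i\<in>{j..<n}. c i * t i) * y j))"
      by (intro sum.cong) (auto simp: ereal_mult_mult mult.commute[where ?'a = real])
    also have "\<dots> = ereal (c n * t n) * S"
      unfolding S_def using y t cn
      by (intro sum_ereal_right_distrib[symmetric])
        (auto intro!: mult_nonneg_nonneg prod_nonneg simp: ereal_zero_le_0_iff)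
    finally show ?thesis by (simp add: add.commute)
  qed
  have "x n \<le> ereal (c n) * S + ereal P * x 0"
    unfolding S_def P_def using Suc by auto
  then have "x (Suc n) \<le> ereal (c (Suc n)) * (y (Suc n) + ereal (t n) * (ereal (c n) * S + ereal P * x 0))"
    using cn[of "Suc n"] t[of n]
    by (intro order_trans[OF Suc.prems(1)[OF lessI]] ereal_mult_left_mono add_left_mono) auto
  also have "\<dots> = ereal (c (Suc n)) * ((y (Suc n) + ereal (c n * t n) * S) + ereal (t n * P) * x 0)"
    using S0 P0 x0 t[of n] cn[of n]
    by (simp add: ereal_right_distrib ereal_zero_le_0_iff add.assoc ereal_mult_mult
        mult.commute[where ?'a = real])
  also have "\<dots> = ereal (c (Suc n)) * (y (Suc n) + ereal (c n * t n) * S)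
      + ereal (c (Suc n)) * (ereal (t n * P) * x 0)"
    using S0 P0 x0 t[of n] cn[of n] y
    by (intro ereal_right_distrib) (auto simp: ereal_zero_le_0_iff)
  \<comment> \<open>The factor \<open>c (Suc n)\<close> meets \<open>t n\<close>, which accounts for
    the shifted index in the product in front of \<open>x 0\<close>.\<close>
  also have "ereal (c (Suc n)) * (ereal (t n * P) * x 0) = ereal (\<Prod>i=1..Suc n. c i * t (i - 1)) * x 0"
    unfolding P_def by (simp add: ereal_mult_mult mult.commute[where ?'a = real] mult.left_commute[where ?'a = real]
        mult.assoc[where ?'a = real])
  finally show ?case unfolding S .
qed

text \<open>Here the initial value is itself controlled by \<open>y 0\<close>, so it becomes the
  summand \<open>j = 0\<close> and no tail remains.\<close>

lemma ereal_linear_recursion: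
  fixes x y :: "nat \<Rightarrow> ereal" and c t :: "nat \<Rightarrow> real"
  assumes init: "x 0 \<le> ereal (c 0) * y 0"
    and step: "\<And>k. k < n \<Longrightarrow> x (Suc k) \<le> ereal (c (Suc k)) * (y (Suc k) + ereal (t k) * x k)"
    and c: "\<And>k. k \<le> n \<Longrightarrow> 0 \<le> c k" and t: "\<And>k. 0 \<le> t k" and y: "\<And>k. 0 \<le> y k"
  shows "x n \<le> ereal (c n) * (\<Sum>j=0..n. ereal (\<Prod>i\<in>{j..<n}. c i * t i) * y j)"
  using step c
proof (induction n)
  case 0
  then show ?case using init by simp
next
  case (Suc n)
  define S where "S = (\<Sum>j=0..n. ereal (\<Prod>i\<in>{j..<n}. c i * t i) * y j)"
  have cn: "0 \<le> c i" if "i \<le> Suc n" for i using Suc.prems(2)[OF that] .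
  have S: "(\<Sum>j=0..Suc n. ereal (\<Prod>i\<in>{j..<Suc n}. c i * t i) * y j) =
      y (Suc n) + ereal (c n * t n) * S"
  proof -
    have "(\<Sum>j=0..n. ereal (\<Prod>i\<in>{j..<Suc n}. c i * t i) * y j) =
        (\<Sum>j=0..n. ereal (c n * t n) * (ereal (\<Prod>i\<in>{j..<n}. c i * t i) * y j))"
      by (intro sum.cong) (auto simp: ereal_mult_mult mult.commute[where ?'a = real])
    also have "\<dots> = ereal (c n * t n) * S"
      unfolding S_def using y t cn
      by (intro sum_ereal_right_distrib[symmetric])
        (auto intro!: mult_nonneg_nonneg prod_nonneg simp: ereal_zero_le_0_iff)
    finally show ?thesis by (simp add: add.commute)
  qed
  have "x n \<le> ereal (c n) * S"
    unfolding S_def using Suc by auto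
  then have "x (Suc n) \<le> ereal (c (Suc n)) * (y (Suc n) + ereal (t n) * (ereal (c n) * S))"
    using cn[of "Suc n"] t[of n]
    by (intro order_trans[OF Suc.prems(1)[OF lessI]] ereal_mult_left_mono add_left_mono) auto
  also have "\<dots> = ereal (c (Suc n)) * (y (Suc n) + ereal (c n * t n) * S)"
    by (simp add: ereal_mult_mult mult.commute[where ?'a = real])
  finally show ?case unfolding S .
qed

text \<open>Yields the sign of the constants in (i) to (iii): a single right-hand side of positive
  norm suffices, even one of infinite norm.\<close>

lemma nonneg_if_ereal_mult_nonneg:
  assumes "0 \<le> B" "B \<le> ereal c * S" "0 < S"
  shows "0 \<le> c"
  using order_trans[OF assms(1,2)] assms(3) by (cases S) (auto simp: zero_le_mult_iff split: if_splits)

subsection \<open>Centred functions and the class Cb\<close>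

text \<open>Since \<open>sin\<close> is bounded it is integrable for every probability measure;
  minus its mean it tests the constants of all three hypotheses at once.\<close>

lemma centred_lipschitz_nonconstant:
  assumes "prob_space M" "sets M = sets borel"
  obtains g where "centred M g" "1-lipschitz_on UNIV g" "0 < sup_norm g" "0 < sup_norm (ext_deriv g)"
proof -
  interpret prob_space M by fact
  have [measurable_cong]: "sets M = sets borel" by fact
  define c where "c = (\<integral>x. sin x \<partial>M)"
  have "integrable M (\<lambda>x. sin x)"
    by (rule integrable_const_bound[of _ 1]) auto
  then have "centred M (\<lambda>x. sin x - c)"
    by (simp add: centred_def c_def prob_space)
  moreover have d: "((\<lambda>x. sin x - c) has_real_derivative cos x) (at x)" for x
    by (auto intro!: derivative_eq_intros)
  moreover have "1-lipschitz_on UNIV (\<lambda>x. sin x - c)"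
  proof (rule lipschitz_onI)
    show "dist (sin x - c) (sin y - c) \<le> 1 * dist x y" for x y :: real
      using field_differentiable_bound[of UNIV "\<lambda>x. sin x - c" cos 1 x y] d
      by (auto simp: dist_real_def)
  qed simp
  moreover have "0 < sup_norm (\<lambda>x. sin x - c)"
  proof -
    \<comment> \<open>The values 0 and 1 of \<open>sin\<close> at these points cannot both equal
      \<open>c\<close>.\<close>
    have "sin 0 - c \<noteq> 0 \<or> sin (pi / 2) - c \<noteq> 0" by auto
    then obtain x where "0 < ereal \<bar>sin x - c\<bar>"
      unfolding ereal_less zero_less_abs_iff by blast
    then show ?thesis using abs_le_sup_norm[of "\<lambda>x. sin x - c" x] by (rule less_le_trans)
  qed
  moreover have "0 < sup_norm (ext_deriv (\<lambda>x. sin x - c))"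
    using abs_le_sup_norm[of "ext_deriv (\<lambda>x. sin x - c)" 0] ext_deriv_eqI[OF d[of 0]]
    by (auto simp: one_ereal_def intro: less_le_trans[of 0 "ereal 1"])
  ultimately show thesis using that by blast
qed

lemma Cb_differentiable: "h \<in> Cb n \<Longrightarrow> Suc k < n \<Longrightarrow> nderiv k h field_differentiable at x"
  by (simp add: Cb_def has_derivs_def)

lemma Cb_sup_norm_finite:
  assumes "h \<in> Cb n" "k \<le> n"
  shows "sup_norm (nderiv k h) < \<infinity>"
proof -
  have "bounded (range (nderiv k h))" using assms by (simp add: Cb_def)
  then obtain M where "\<And>x. \<bar>nderiv k h x\<bar> \<le> M" by (auto simp: bounded_iff)
  then have "sup_norm (nderiv k h) \<le> ereal M" by (intro sup_norm_least) simp
  then show ?thesis by (rule le_less_trans) simp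
qed

text \<open>For \<open>k = n - 1\<close> this is part of the definition; below that, the derivative
  exists everywhere and is bounded.\<close>

lemma Cb_ac_differentiable:
  assumes "h \<in> Cb n" "k < n"
  shows "ac_differentiable (nderiv k h)"
proof (cases "Suc k = n")
  case True
  then show ?thesis using assms by (auto simp: Cb_def has_derivs_def)
next
  case False
  have "bounded (range (nderiv (Suc k) h))" using assms by (simp add: Cb_def del: funpow.simps)
  then show ?thesis using assms False
    by (intro differentiable_imp_ac_differentiable Cb_differentiable) auto
qed

text \<open>Supplies the Lipschitz condition on right-hand sides in (iii).\<close>

lemma ac_differentiable_sup_norm_lipschitz:
  assumes "ac_differentiable g" "sup_norm (ext_deriv g) < \<infinity>"
  shows "\<exists>K. K-lipschitz_on UNIV g"
proof -
  obtain M where "sup_norm (ext_deriv g) = ereal M" "0 \<le> M"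
    using assms(2) sup_norm_nonneg[of "ext_deriv g"] by (cases "sup_norm (ext_deriv g)") auto
  then have "M-lipschitz_on UNIV g"
    using abs_le_sup_norm[of "ext_deriv g"] by (intro ac_differentiable_imp_lipschitz assms(1)) auto
  then show ?thesis by blast
qed

text \<open>Adding a differentiable \<open>w\<close> does not change where \<open>u\<close> is
  differentiable. The default value 0 is not additive, whence the case distinction.\<close>

lemma ext_deriv_add:
  assumes "(w has_real_derivative w') (at x)"
  shows "ext_deriv (\<lambda>y. u y + w y) x = (if u field_differentiable at x then ext_deriv u x + w' else 0)"
proof (cases "u field_differentiable at x")
  case True
  then show ?thesis
    using ext_deriv_eqI[OF DERIV_add[OF has_real_derivative_ext_deriv assms]] by simp
next
  case False
  have "\<not> (\<lambda>y. u y + w y) field_differentiable at x"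
  proof
    assume "(\<lambda>y. u y + w y) field_differentiable at x"
    from field_differentiable_diff[OF this, of w] assms have "u field_differentiable at x"
      by (auto simp: field_differentiable_def)
    with False show False ..
  qed
  with False show ?thesis by (simp add: ext_deriv_def)
qed

subsection \<open>Iterated derivatives of the solution\<close>

lemma enat_le_less_trans: "enat n < M \<Longrightarrow> k \<le> n \<Longrightarrow> enat k < M"
  by (auto intro: le_less_trans[of _ "enat n"])

locale eigen_stein_hierarchy = stein_hierarchy +
  fixes \<alpha> :: "nat \<Rightarrow> real"
  assumes eigen: "\<And>k u. enat k < N + 1 \<Longrightarrow> centred (\<mu> k) u \<Longrightarrow>
    AE x in lborel. diff_op p (b k) (sol k u) x = \<alpha> k * sol k u x"
begin

text \<open>Without derivatives in the operator (p = 0) the solution is the quotient of the right-hand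
  side and the coefficient. That coefficient is continuous, because the linking identity
  differentiates it as the image of the constant function 1, and it has at most one zero, because
  the point mass at a zero satisfies the characterizing equations.\<close>

lemma coefficient_zero_unique:
  assumes "p = 0" "enat k < N + 1" "a k 0 x = 0" "a k 0 y = 0"
  shows "x = y"
proof -
  obtain F where F: "\<And>\<nu>. prob_space \<nu> \<Longrightarrow> sets \<nu> = sets borel \<Longrightarrow>
      \<nu> = \<mu> k \<longleftrightarrow> (\<forall>f\<in>F. integrable \<nu> (diff_op p (a k) f) \<and> (\<integral>x. diff_op p (a k) f x \<partial>\<nu>) = 0)"
    using characterizing[OF assms(2)] unfolding characterizing_def by metis
  \<comment> \<open>The measure \<open>\<mu> k\<close> satisfies its own characterizing equations,
    so these images are integrable and hence Borel.\<close>
  have meas: "diff_op p (a k) f \<in> borel_measurable borel" if "f \<in> F" for f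
    using F[of "\<mu> k"] prob[OF assms(2)] that borel_measurable_integrable
    by (metis measurable_cong_sets)
  have eq: "return borel z = \<mu> k" if z: "a k 0 z = 0" for z
  proof -
    interpret prob_space "return borel z" by (rule prob_space_return) simp
    have "integrable (return borel z) (diff_op p (a k) f) \<and>
        (\<integral>x. diff_op p (a k) f x \<partial>return borel z) = 0" if "f \<in> F" for f
    proof
      note [measurable] = meas[OF that]
      have zero: "diff_op p (a k) f z = 0" using z by (simp add: diff_op_def assms(1))
      show "integrable (return borel z) (diff_op p (a k) f)"
        by (rule integrable_const_bound[of _ 0]) (simp_all add: AE_return zero)
      show "(\<integral>x. diff_op p (a k) f x \<partial>return borel z) = 0"
        by (simp add: integral_return zero)
    qed
    then show ?thesis using F[of "return borel z"] prob_space_axioms by simp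
  qed
  have "return borel x = return borel y" using eq assms(3,4) by simp
  then have "emeasure (return borel x) {x} = emeasure (return borel y) {x}" by simp
  then show ?thesis by (simp split: split_indicator_asm)
qed

text \<open>For \<open>p > 0\<close> the solution is differentiable, hence continuous, almost
  everywhere; for \<open>p = 0\<close> it is a quotient of continuous functions.\<close>

lemma solution_borel_version:
  assumes k: "enat (k + 1) < N + 1" and u: "centred (\<mu> k) u" "continuous_on UNIV u"
  obtains q where "q \<in> borel_measurable borel" "AE x in lborel. q x = sol k u x"
proof -
  have k': "enat k < N + 1" by (rule enat_le_less_trans[OF k]) simp
  note sol = solution[OF k' u(1), unfolded solves_def]
  show thesis
  proof (cases "p = 0")
    case False
    then have "AE x in lborel. isCont (sol k u) x"
      using sol by (auto elim!: eventually_mono dest!: spec[of _ 0]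
          intro: field_differentiable_imp_continuous_at)
    then show thesis by (rule AE_continuous_borel_version) (rule that)
  next
    case True
    have "diff_op p (a k) (\<lambda>_. 1) = a k 0" by (auto simp: diff_op_def True)
    then have "isCont (a k 0) x" for x
      using linked[OF k, of "\<lambda>_. 1" x] by (auto simp: True dest: DERIV_isCont)
    then have "a k 0 \<in> borel_measurable borel"
      by (intro borel_measurable_continuous_onI) (simp add: continuous_on_eq_continuous_at)
    moreover have "u \<in> borel_measurable borel"
      using u(2) by (rule borel_measurable_continuous_onI)
    ultimately have "(\<lambda>x. u x / a k 0 x) \<in> borel_measurable borel" by measurable
    moreover have "AE x in lborel. u x / a k 0 x = sol k u x"
    proof -
      have "AE x in lborel. a k 0 x \<noteq> 0"
      proof (cases "\<exists>z. a k 0 z = 0")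
        case zero: True
        then obtain z where "a k 0 z = 0" ..
        then have "a k 0 x \<noteq> 0" if "x \<noteq> z" for x
          using coefficient_zero_unique[OF True k'] that by blast
        with AE_lborel_singleton[of z] show ?thesis by (auto elim: eventually_mono)
      qed simp
      with sol show ?thesis
        by eventually_elim (auto simp: diff_op_def True divide_eq_eq mult.commute)
    qed
    ultimately show thesis by (rule that)
  qed
qed

section \<open>Passage from one Stein equation to the next\<close>

lemma derivative_solves_next:
  assumes "enat (Suc k) < N + 1" "centred (\<mu> k) u" "ac_differentiable u" "g \<in> borel_measurable borel"
    and "AE x in lborel. g x = ext_deriv u x + \<alpha> k * sol k u x"
  shows "centred (\<mu> (Suc k)) g" "ac_differentiable (sol k u)"
    "AE x in lborel. ext_deriv (sol k u) x = sol (Suc k) g x"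
proof -
  have "enat k < N + 1" by (rule enat_le_less_trans[OF assms(1)]) simp
  from eigen[OF this assms(2)] assms(5)
  have "AE x in lborel. g x = ext_deriv u x + diff_op p (b k) (sol k u) x"
    by eventually_elim simp
  from derivative_of_solution[OF _ assms(2-4) this] assms(1)
  show "centred (\<mu> (Suc k)) g" "ac_differentiable (sol k u)"
    "AE x in lborel. ext_deriv (sol k u) x = sol (Suc k) g x" by auto
qed

text \<open>Absolute continuity is part of what the standing assumption concludes, so it is enough
  to exhibit one Borel version of the next right-hand side.\<close>

lemma ac_differentiable_solution:
  assumes "enat (Suc k) < N + 1" "centred (\<mu> k) u" "ac_differentiable u"
  shows "ac_differentiable (sol k u)"
proof -
  obtain q where q: "q \<in> borel_measurable borel" "AE x in lborel. q x = sol k u x"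
    using solution_borel_version[of k u] assms ac_differentiable_imp_continuous by auto
  obtain d where d: "d \<in> borel_measurable borel" "AE x in lborel. d x = ext_deriv u x"
    using ext_deriv_borel_version[OF assms(3)] by blast
  have "(\<lambda>x. d x + \<alpha> k * q x) \<in> borel_measurable borel"
    using q(1) d(1) by measurable
  moreover have "AE x in lborel. d x + \<alpha> k * q x = ext_deriv u x + \<alpha> k * sol k u x"
    using q(2) d(2) by eventually_elim simp
  ultimately show ?thesis by (rule derivative_solves_next(2)[OF assms])
qed

text \<open>For \<open>k = 0\<close> the empty sum cancels the term with the truncated index
  \<open>k - 1\<close>, leaving \<open>h\<close>.\<close>

definition rhs :: "(real \<Rightarrow> real) \<Rightarrow> nat \<Rightarrow> real \<Rightarrow> real" where
  "rhs h k x = nderiv k h x + (\<Sum>i<k. \<alpha> i) * nderiv (k - 1) (sol 0 h) x"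

text \<open>The induction invariant. The equation for the derivative and the differentiability of
  lower orders hold at every point, so that the next differentiation makes sense.\<close>

definition solves_up_to :: "(real \<Rightarrow> real) \<Rightarrow> nat \<Rightarrow> bool" where
  "solves_up_to h k \<longleftrightarrow> centred (\<mu> k) (rhs h k) \<and> ac_differentiable (rhs h k) \<and>
     nderiv k (sol 0 h) = sol k (rhs h k) \<and>
     (\<forall>j<k. \<forall>x. nderiv j (sol 0 h) field_differentiable at x)"

lemma ext_deriv_rhs:
  assumes "solves_up_to h k"
  shows "ext_deriv (rhs h k) x = (if nderiv k h field_differentiable at x
    then nderiv (Suc k) h x + (\<Sum>i<k. \<alpha> i) * nderiv k (sol 0 h) x else 0)"
proof -
  have "((\<lambda>x. (\<Sum>i<k. \<alpha> i) * nderiv (k - 1) (sol 0 h) x) has_real_derivative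
      (\<Sum>i<k. \<alpha> i) * nderiv k (sol 0 h) x) (at x)"
  proof (cases k)
    case (Suc j)
    then have "nderiv j (sol 0 h) field_differentiable at x"
      using assms by (simp add: solves_up_to_def)
    from DERIV_cmult[OF has_real_derivative_ext_deriv[OF this]] show ?thesis using Suc by simp
  qed simp
  from ext_deriv_add[OF this, of "nderiv k h"] show ?thesis
    by (simp add: rhs_def[abs_def])
qed

text \<open>Where \<open>nderiv k h\<close> is not differentiable, the left-hand side is 0, so the
  bound holds at every point.\<close>

lemma sup_norm_ext_deriv_rhs:
  assumes "solves_up_to h k"
  shows "sup_norm (ext_deriv (rhs h k)) \<le>
    sup_norm (nderiv (Suc k) h) + ereal \<bar>\<Sum>i<k. \<alpha> i\<bar> * sup_norm (nderiv k (sol 0 h))"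
proof (rule order_trans[OF sup_norm_least sup_norm_add_cmult])
  fix x
  have "\<bar>ext_deriv (rhs h k) x\<bar> \<le> \<bar>nderiv (Suc k) h x + (\<Sum>i<k. \<alpha> i) * nderiv k (sol 0 h) x\<bar>"
    unfolding ext_deriv_rhs[OF assms] by simp
  also note abs_le_sup_norm[of "\<lambda>x. nderiv (Suc k) h x + (\<Sum>i<k. \<alpha> i) * nderiv k (sol 0 h) x" x]
  finally show "ereal \<bar>ext_deriv (rhs h k) x\<bar> \<le>
      sup_norm (\<lambda>x. nderiv (Suc k) h x + (\<Sum>i<k. \<alpha> i) * nderiv k (sol 0 h) x)"
    by simp
qed

lemma ac_differentiable_nderiv_solution:
  assumes "solves_up_to h k" "enat (Suc k) < N + 1"
  shows "ac_differentiable (nderiv k (sol 0 h))"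
  using assms ac_differentiable_solution[of k "rhs h k"] by (simp add: solves_up_to_def)

text \<open>Differentiating \<open>rhs h k\<close> gives the first \<open>k\<close> constants times
  \<open>nderiv k (sol 0 h)\<close>, and the operator with coefficients \<open>b k\<close> adds
  \<open>\<alpha> k\<close>. An arbitrary Borel version \<open>g\<close> is allowed because at the
  last order the derivative of \<open>h\<close> may exist only almost everywhere.\<close>

lemma next_right_hand_side:
  assumes "solves_up_to h k" "enat (Suc k) < N + 1" "ac_differentiable (nderiv k h)"
    and g: "g \<in> borel_measurable borel"
      "AE x in lborel. g x = nderiv (Suc k) h x + (\<Sum>i<Suc k. \<alpha> i) * nderiv k (sol 0 h) x"
  shows "centred (\<mu> (Suc k)) g" "AE x in lborel. nderiv (Suc k) (sol 0 h) x = sol (Suc k) g x"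
proof -
  have *: "centred (\<mu> k) (rhs h k)" "ac_differentiable (rhs h k)"
    and eq: "nderiv k (sol 0 h) = sol k (rhs h k)"
    using assms(1) by (auto simp: solves_up_to_def)
  have "AE x in lborel. nderiv k h field_differentiable at x"
    using assms(3) by (simp add: ac_differentiable_def)
  with g(2) have "AE x in lborel. g x = ext_deriv (rhs h k) x + \<alpha> k * sol k (rhs h k) x"
    unfolding eq[symmetric]
    by eventually_elim (simp add: ext_deriv_rhs[OF assms(1)] algebra_simps)
  note next_step = derivative_solves_next[OF assms(2) * g(1) this]
  show "centred (\<mu> (Suc k)) g" by (rule next_step)
  show "AE x in lborel. nderiv (Suc k) (sol 0 h) x = sol (Suc k) g x"
    using next_step(3) by (simp add: eq)
qed

text \<open>Induction on \<open>k\<close>, upgrading the almost everywhere identity at each stage.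
  It stops before \<open>n\<close>, since absolute continuity of the right-hand side is lost at
  order \<open>n\<close>.\<close>

lemma solves_up_to:
  assumes h: "h \<in> Cb n" "centred (\<mu> 0) h" and n: "enat n < N + 1" and "k < n"
  shows "solves_up_to h k"
  using \<open>k < n\<close>
proof (induction k)
  case 0
  have "rhs h 0 = h" by (simp add: rhs_def[abs_def])
  with 0 h Cb_ac_differentiable[OF h(1), of 0] show ?case by (simp add: solves_up_to_def)
next
  case (Suc k)
  have IH: "solves_up_to h k" using Suc by simp
  have N: "enat (Suc k) < N + 1" "enat (Suc (Suc k)) < N + 1"
    using Suc.prems by (auto intro: enat_le_less_trans[OF n])
  note ac = ac_differentiable_nderiv_solution[OF IH N(1)]
  have ac_rhs: "ac_differentiable (rhs h (Suc k))"
    using ac_differentiable_add_cmult[OF Cb_ac_differentiable[OF h(1) Suc.prems] ac]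
    by (simp add: rhs_def[abs_def])
  then have "rhs h (Suc k) \<in> borel_measurable borel"
    by (intro borel_measurable_continuous_onI ac_differentiable_imp_continuous)
  from next_right_hand_side[OF IH N(1) Cb_ac_differentiable[OF h(1)] this] Suc.prems
  have c: "centred (\<mu> (Suc k)) (rhs h (Suc k))"
    and ae: "AE x in lborel. ext_deriv (nderiv k (sol 0 h)) x = sol (Suc k) (rhs h (Suc k)) x"
    by (auto simp: rhs_def)
  \<comment> \<open>Regularity at level \<open>Suc k\<close> needs the hierarchy at level
    \<open>Suc (Suc k)\<close>, which is at most \<open>n\<close>.\<close>
  have "continuous_on UNIV (sol (Suc k) (rhs h (Suc k)))"
    by (intro ac_differentiable_imp_continuous ac_differentiable_solution N c ac_rhs)
  note d = ac_differentiable_continuous_derivative[OF ac this ae]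
  have "nderiv (Suc k) (sol 0 h) = sol (Suc k) (rhs h (Suc k))"
    using ext_deriv_eqI[OF d] by auto
  moreover have "nderiv k (sol 0 h) field_differentiable at x" for x
    using d field_differentiable_def by blast
  ultimately show ?case
    using IH c ac_rhs unfolding solves_up_to_def less_Suc_eq by blast
qed

section \<open>One recursion step for each of the three kinds of bounds\<close>

context
  fixes h :: "real \<Rightarrow> real" and n :: nat
  assumes h: "h \<in> Cb n" "centred (\<mu> 0) h" and n: "enat n < N + 1"
begin

lemmas enat_le = enat_le_less_trans[OF n]

lemma ac_nderiv_solution: "k < n \<Longrightarrow> ac_differentiable (nderiv k (sol 0 h))"
  using ac_differentiable_nderiv_solution[OF solves_up_to[OF h n]] enat_le[of "Suc k"] by simp

text \<open>Ensures that the estimates concern genuine derivatives rather than default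
  values.\<close>

lemma has_derivs_solution: "has_derivs n (sol 0 h)"
proof (cases n)
  case (Suc k)
  have "nderiv m (sol 0 h) field_differentiable at x" if "Suc m < n" for m x
    using solves_up_to[OF h n, of k] that by (simp add: solves_up_to_def Suc)
  then show ?thesis using ac_nderiv_solution[of k] by (simp add: has_derivs_def Suc)
qed (simp add: has_derivs_def)

text \<open>The bound is applied to a Borel version of the right-hand side at level
  \<open>Suc k\<close>, which may equal \<open>n\<close>; the resulting almost everywhere estimate
  then holds everywhere.\<close>

lemma sup_norm_nderiv_le_solution:
  assumes bound: "\<And>u. centred (\<mu> (Suc k)) u \<Longrightarrow> sup_norm (sol (Suc k) u) \<le> ereal C * sup_norm u"
    and "0 \<le> C" "k < n"
  shows "sup_norm (nderiv (Suc k) (sol 0 h)) \<le> ereal C *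
    (sup_norm (nderiv (Suc k) h) + ereal \<bar>\<Sum>i<Suc k. \<alpha> i\<bar> * sup_norm (nderiv k (sol 0 h)))"
    (is "_ \<le> ?B")
proof -
  note ac = ac_nderiv_solution[OF \<open>k < n\<close>]
  obtain q where q: "q \<in> borel_measurable borel" "AE x in lborel. q x = ext_deriv (nderiv k h) x"
    "sup_norm q \<le> sup_norm (ext_deriv (nderiv k h))"
    using ext_deriv_borel_version[OF Cb_ac_differentiable[OF h(1) \<open>k < n\<close>]] by blast
  define g where "g x = q x + (\<Sum>i<Suc k. \<alpha> i) * nderiv k (sol 0 h) x" for x
  have "nderiv k (sol 0 h) \<in> borel_measurable borel"
    using ac by (intro borel_measurable_continuous_onI ac_differentiable_imp_continuous)
  then have gm: "g \<in> borel_measurable borel"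
    unfolding g_def using q(1) by measurable
  have "AE x in lborel. g x = nderiv (Suc k) h x + (\<Sum>i<Suc k. \<alpha> i) * nderiv k (sol 0 h) x"
    using q(2) by eventually_elim (simp add: g_def)
  note g = next_right_hand_side[OF solves_up_to[OF h n \<open>k < n\<close>] enat_le
      Cb_ac_differentiable[OF h(1) \<open>k < n\<close>] gm this]
  have "sup_norm g \<le> sup_norm (nderiv (Suc k) h) +
      ereal \<bar>\<Sum>i<Suc k. \<alpha> i\<bar> * sup_norm (nderiv k (sol 0 h))"
    unfolding g_def using q(3) by (intro order_trans[OF sup_norm_add_cmult] add_right_mono) simp
  with \<open>0 \<le> C\<close> have "ereal C * sup_norm g \<le> ?B" by (intro ereal_mult_left_mono) auto
  with bound[OF g(1)] \<open>k < n\<close> have sol: "sup_norm (sol (Suc k) g) \<le> ?B"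
    by (auto simp del: sum.lessThan_Suc funpow.simps intro: order_trans)
  have "AE x in lborel. ereal \<bar>ext_deriv (nderiv k (sol 0 h)) x\<bar> \<le> ?B"
    using g(2)[OF Suc_leI[OF \<open>k < n\<close>]] order_trans[OF abs_le_sup_norm sol]
    by (auto elim!: eventually_mono)
  moreover have "0 \<le> ?B" using sup_norm_nonneg sol by (rule order_trans)
  ultimately show ?thesis using sup_norm_ext_deriv_le_AE[OF ac] by simp
qed

text \<open>Bounding the derivative of the solution at level \<open>k\<close> skips one order: the
  right-hand side involves only the derivative of order \<open>k - 1\<close>, hence the step 2 in
  (ii).\<close>

lemma sup_norm_nderiv_le_derivative:
  assumes bound: "\<And>u. centred (\<mu> k) u \<Longrightarrow> sup_norm (ext_deriv (sol k u)) \<le> ereal D * sup_norm u"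
    and "0 \<le> D" "k < n"
  shows "sup_norm (nderiv (Suc k) (sol 0 h)) \<le> ereal D *
    (sup_norm (nderiv k h) + ereal \<bar>\<Sum>i<k. \<alpha> i\<bar> * sup_norm (nderiv (k - 1) (sol 0 h)))"
proof -
  have "centred (\<mu> k) (rhs h k)" "nderiv k (sol 0 h) = sol k (rhs h k)"
    using solves_up_to[OF h n \<open>k < n\<close>] by (auto simp: solves_up_to_def)
  with bound[of "rhs h k"] have "sup_norm (nderiv (Suc k) (sol 0 h)) \<le> ereal D * sup_norm (rhs h k)"
    by simp
  also have "\<dots> \<le> ereal D *
      (sup_norm (nderiv k h) + ereal \<bar>\<Sum>i<k. \<alpha> i\<bar> * sup_norm (nderiv (k - 1) (sol 0 h)))"
    unfolding rhs_def[abs_def] using \<open>0 \<le> D\<close> by (intro ereal_mult_left_mono sup_norm_add_cmult) auto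
  finally show ?thesis .
qed

text \<open>The bound is available only for Lipschitz right-hand sides, so finiteness of the norm
  must be carried along with the estimate.\<close>

lemma sup_norm_nderiv_le_derivatives:
  assumes bound: "\<And>u. centred (\<mu> k) u \<Longrightarrow> \<exists>K. K-lipschitz_on UNIV u \<Longrightarrow>
      sup_norm (ext_deriv (sol k u)) \<le> ereal E * sup_norm (ext_deriv u)"
    and "0 \<le> E" "k < n" and finite: "k \<noteq> 0 \<Longrightarrow> sup_norm (nderiv k (sol 0 h)) < \<infinity>"
  shows "sup_norm (nderiv (Suc k) (sol 0 h)) \<le> ereal E *
    (sup_norm (nderiv (Suc k) h) + ereal \<bar>\<Sum>i<k. \<alpha> i\<bar> * sup_norm (nderiv k (sol 0 h)))"
    (is "_ \<le> _ * ?B") and "sup_norm (nderiv (Suc k) (sol 0 h)) < \<infinity>"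
proof -
  note su = solves_up_to[OF h n \<open>k < n\<close>]
  have c: "centred (\<mu> k) (rhs h k)" "ac_differentiable (rhs h k)" "nderiv k (sol 0 h) = sol k (rhs h k)"
    using su by (auto simp: solves_up_to_def)
  have hfin: "sup_norm (nderiv (Suc k) h) < \<infinity>"
    using Cb_sup_norm_finite[OF h(1), of "Suc k"] \<open>k < n\<close> by simp
  \<comment> \<open>For \<open>k = 0\<close> the coefficient vanishes, and
    \<open>0 * \<infinity> = 0\<close> covers an unbounded solution.\<close>
  have "ereal \<bar>\<Sum>i<k. \<alpha> i\<bar> * sup_norm (nderiv k (sol 0 h)) < \<infinity>"
    using finite sup_norm_nonneg[of "nderiv k (sol 0 h)"]
    by (cases "k = 0"; cases "sup_norm (nderiv k (sol 0 h))") (auto simp flip: zero_ereal_def)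
  with hfin have fin: "?B < \<infinity>" by simp
  note le = sup_norm_ext_deriv_rhs[OF su]
  have "sup_norm (nderiv (Suc k) (sol 0 h)) \<le> ereal E * sup_norm (ext_deriv (rhs h k))"
    using bound[OF c(1) ac_differentiable_sup_norm_lipschitz[OF c(2) le_less_trans[OF le fin]]]
    by (simp add: c(3))
  also have "\<dots> \<le> ereal E * ?B" using \<open>0 \<le> E\<close> by (intro ereal_mult_left_mono le) auto
  finally show B: "sup_norm (nderiv (Suc k) (sol 0 h)) \<le> ereal E * ?B" .
  have "0 \<le> ?B" using sup_norm_nonneg le by (rule order_trans)
  moreover have "ereal E * B < \<infinity>" if "0 \<le> B" "B < \<infinity>" for B
    using that by (cases B) auto
  ultimately have "ereal E * ?B < \<infinity>" using fin by blast
  with B show "sup_norm (nderiv (Suc k) (sol 0 h)) < \<infinity>" by (rule le_less_trans)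
qed

end

end

theorem lemma2p3:
  fixes N :: enat and p n :: nat
    and \<mu> :: "nat \<Rightarrow> real measure"
    and a b :: "nat \<Rightarrow> nat \<Rightarrow> real \<Rightarrow> real"
    and sol :: "nat \<Rightarrow> (real \<Rightarrow> real) \<Rightarrow> real \<Rightarrow> real"
    and \<alpha> s :: "nat \<Rightarrow> real"
    and h f :: "real \<Rightarrow> real"
  assumes standing: "stein_hierarchy N p \<mu> a b sol"
    and T_alpha: "\<And>j g. enat j < N + 1 \<Longrightarrow> centred (\<mu> j) g \<Longrightarrow>
           (AE x in lborel. diff_op p (b j) (sol j g) x = \<alpha> j * sol j g x)"
    and n: "enat n < N + 1"
    and h: "h \<in> Cb n" "centred (\<mu> 0) h"
    and f: "f = sol 0 h"
    and s: "\<And>j. s j = \<bar>\<Sum>i\<le>j. \<alpha> i\<bar>"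
  shows "has_derivs n f \<and>
    (\<forall>C :: nat \<Rightarrow> real.
      (\<forall>l g. enat l < N + 1 \<longrightarrow> centred (\<mu> l) g \<longrightarrow>
          sup_norm (sol l g) \<le> ereal (C l) * sup_norm g) \<longrightarrow>
      sup_norm (nderiv n f) \<le>
        ereal (C n) * (\<Sum>j=0..n. ereal (\<Prod>i\<in>{j..<n}. C i * s i) * sup_norm (nderiv j h))) \<and>
    (\<forall>D :: nat \<Rightarrow> real.
      (\<forall>l g. enat l < N + 1 \<longrightarrow> centred (\<mu> l) g \<longrightarrow>
          sup_norm (ext_deriv (sol l g)) \<le> ereal (D l) * sup_norm g) \<longrightarrow>
      (\<forall>k. n = 2 * k + 1 \<longrightarrow>
        sup_norm (nderiv (2 * k + 1) f) \<le>
          ereal (D (2 * k)) *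
            (\<Sum>j=0..k. ereal (\<Prod>i\<in>{j..<k}. D (2 * i) * s (2 * i + 1)) *
               sup_norm (nderiv (2 * j) h))) \<and>
      (\<forall>k. n = 2 * k \<longrightarrow>
        sup_norm (nderiv (2 * k) f) \<le>
          ereal (D (2 * k - 1)) *
            (\<Sum>j=1..k. ereal (\<Prod>i\<in>{j..<k}. D (2 * i - 1) * s (2 * i)) *
               sup_norm (nderiv (2 * j - 1) h))
          + sup_norm f * ereal (\<Prod>i=1..k. D (2 * i - 1) * s (2 * i - 2)))) \<and>
    (\<forall>E :: nat \<Rightarrow> real.
      1 \<le> n \<longrightarrow>
      (\<forall>l g. enat l < N + 1 \<longrightarrow> centred (\<mu> l) g \<longrightarrow> (\<exists>K. K-lipschitz_on UNIV g) \<longrightarrow>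
          sup_norm (ext_deriv (sol l g)) \<le> ereal (E l) * sup_norm (ext_deriv g)) \<longrightarrow>
      sup_norm (nderiv n f) \<le>
        ereal (E (n - 1)) *
          (\<Sum>j=1..n. ereal (\<Prod>i\<in>{j..<n}. E (i - 1) * s (i - 1)) * sup_norm (nderiv j h)))"
proof -
  have "eigen_stein_hierarchy N p \<mu> a b sol \<alpha>"
    using T_alpha by (intro eigen_stein_hierarchy.intro standing eigen_stein_hierarchy_axioms.intro)
  then interpret eigen_stein_hierarchy N p \<mu> a b sol \<alpha> .
  note enat_le = enat_le_less_trans[OF n]
  have s0: "0 \<le> s j" for j by (simp add: s)
  have s_Suc: "\<bar>\<Sum>i<Suc k. \<alpha> i\<bar> = s k" for k by (simp only: s lessThan_Suc_atMost)
  have test: "\<exists>g. centred (\<mu> l) g \<and> (\<exists>K. K-lipschitz_on UNIV g) \<and>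
      0 < sup_norm g \<and> 0 < sup_norm (ext_deriv g)" if "l \<le> n" for l
    using centred_lipschitz_nonconstant[of "\<mu> l"] prob[OF enat_le[OF that]] by metis
  show ?thesis
  proof (intro conjI allI impI)
    show "has_derivs n f" unfolding f by (rule has_derivs_solution[OF h n])
  next
    fix C :: "nat \<Rightarrow> real"
    assume C: "\<forall>l g. enat l < N + 1 \<longrightarrow> centred (\<mu> l) g \<longrightarrow>
        sup_norm (sol l g) \<le> ereal (C l) * sup_norm g"
    have C0: "0 \<le> C l" if "l \<le> n" for l
      using test[OF that] C enat_le[OF that] nonneg_if_ereal_mult_nonneg[OF sup_norm_nonneg] by blast
    show "sup_norm (nderiv n f) \<le>
        ereal (C n) * (\<Sum>j=0..n. ereal (\<Prod>i\<in>{j..<n}. C i * s i) * sup_norm (nderiv j h))"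
    proof (rule ereal_linear_recursion[where x = "\<lambda>k. sup_norm (nderiv k f)"])
      show "sup_norm (nderiv 0 f) \<le> ereal (C 0) * sup_norm (nderiv 0 h)"
        using C enat_le[of 0] h(2) by (simp add: f)
      show "sup_norm (nderiv (Suc k) f) \<le>
          ereal (C (Suc k)) * (sup_norm (nderiv (Suc k) h) + ereal (s k) * sup_norm (nderiv k f))"
        if "k < n" for k
        using sup_norm_nderiv_le_solution[OF h n _ C0 that] C enat_le that
        unfolding f s_Suc by (meson Suc_leI)
    qed (use C0 s0 sup_norm_nonneg in auto)
  next
    fix D :: "nat \<Rightarrow> real" and k
    assume D: "\<forall>l g. enat l < N + 1 \<longrightarrow> centred (\<mu> l) g \<longrightarrow>
        sup_norm (ext_deriv (sol l g)) \<le> ereal (D l) * sup_norm g"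
    have D0: "0 \<le> D l" if "l \<le> n" for l
      using test[OF that] D enat_le[OF that] nonneg_if_ereal_mult_nonneg[OF sup_norm_nonneg] by blast
    have step: "sup_norm (nderiv (Suc l) f) \<le> ereal (D l) *
        (sup_norm (nderiv l h) + ereal \<bar>\<Sum>i<l. \<alpha> i\<bar> * sup_norm (nderiv (l - 1) f))" if "l < n" for l
      using sup_norm_nderiv_le_derivative[OF h n _ D0 that] D enat_le that
      unfolding f by (meson less_imp_le)
    show "sup_norm (nderiv (2 * k + 1) f) \<le> ereal (D (2 * k)) *
        (\<Sum>j=0..k. ereal (\<Prod>i\<in>{j..<k}. D (2 * i) * s (2 * i + 1)) * sup_norm (nderiv (2 * j) h))"
      if "n = 2 * k + 1"
    \<comment> \<open>Order \<open>2 * l + 3\<close> is bounded through order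
      \<open>2 * l + 1\<close>; the coefficient sums the first \<open>2 * l + 2\<close> constants
      and is thus \<open>s (2 * l + 1)\<close>.\<close>
    proof (rule ereal_linear_recursion[where x = "\<lambda>k. sup_norm (nderiv (2 * k + 1) f)"
          and y = "\<lambda>k. sup_norm (nderiv (2 * k) h)"])
      show "sup_norm (nderiv (2 * 0 + 1) f) \<le> ereal (D (2 * 0)) * sup_norm (nderiv (2 * 0) h)"
        using step[of 0] that by (simp flip: zero_ereal_def)
      show "sup_norm (nderiv (2 * Suc l + 1) f) \<le> ereal (D (2 * Suc l)) *
          (sup_norm (nderiv (2 * Suc l) h) + ereal (s (2 * l + 1)) * sup_norm (nderiv (2 * l + 1) f))"
        if "l < k" for l
        using step[of "Suc (2 * l + 1)"] that \<open>n = 2 * k + 1\<close> unfolding s_Suc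
        by (simp del: funpow.simps)
    qed (use D0 s0 sup_norm_nonneg that in auto)
    show "sup_norm (nderiv (2 * k) f) \<le> ereal (D (2 * k - 1)) *
        (\<Sum>j=1..k. ereal (\<Prod>i\<in>{j..<k}. D (2 * i - 1) * s (2 * i)) * sup_norm (nderiv (2 * j - 1) h))
        + sup_norm f * ereal (\<Prod>i=1..k. D (2 * i - 1) * s (2 * i - 2))"
      if "n = 2 * k"
    proof -
      have "sup_norm (nderiv (2 * k) f) \<le> ereal (D (2 * k - 1)) *
          (\<Sum>j=1..k. ereal (\<Prod>i\<in>{j..<k}. D (2 * i - 1) * s (2 * i)) * sup_norm (nderiv (2 * j - 1) h))
          + ereal (\<Prod>i=1..k. D (2 * i - 1) * s (2 * (i - 1))) * sup_norm (nderiv (2 * 0) f)"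
      \<comment> \<open>At index 0 truncated subtraction makes \<open>c\<close> equal to
        \<open>D 0\<close>, which only ever multiplies an empty sum.\<close>
      proof (rule ereal_linear_recursion_tail[where x = "\<lambda>k. sup_norm (nderiv (2 * k) f)"
            and y = "\<lambda>k. sup_norm (nderiv (2 * k - 1) h)" and t = "\<lambda>k. s (2 * k)"
            and c = "\<lambda>k. D (2 * k - 1)"])
        show "sup_norm (nderiv (2 * Suc l) f) \<le> ereal (D (2 * Suc l - 1)) *
            (sup_norm (nderiv (2 * Suc l - 1) h) + ereal (s (2 * l)) * sup_norm (nderiv (2 * l) f))"
          if "l < k" for l
          using step[of "Suc (2 * l)"] that \<open>n = 2 * k\<close> unfolding s_Suc
          by (simp del: funpow.simps)
      qed (use D0 s0 sup_norm_nonneg that in auto)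
      then show ?thesis by (simp add: diff_mult_distrib2 mult.commute)
    qed
  next
    fix E :: "nat \<Rightarrow> real"
    assume "1 \<le> n" and E: "\<forall>l g. enat l < N + 1 \<longrightarrow> centred (\<mu> l) g \<longrightarrow> (\<exists>K. K-lipschitz_on UNIV g) \<longrightarrow>
        sup_norm (ext_deriv (sol l g)) \<le> ereal (E l) * sup_norm (ext_deriv g)"
    have E0: "0 \<le> E l" if "l \<le> n" for l
      using test[OF that] E enat_le[OF that] nonneg_if_ereal_mult_nonneg[OF sup_norm_nonneg] by blast
    have bound: "sup_norm (ext_deriv (sol l g)) \<le> ereal (E l) * sup_norm (ext_deriv g)"
      if "l < n" "centred (\<mu> l) g" "\<exists>K. K-lipschitz_on UNIV g" for l g
      using E enat_le[of l] that by simp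
    \<comment> \<open>Finiteness is proved first, by its own induction starting from order 1; the
      norm of \<open>f\<close> itself may be infinite.\<close>
    have finite: "sup_norm (nderiv (Suc l) f) < \<infinity>" if "l < n" for l
      using that
    proof (induction l)
      case 0
      show ?case unfolding f
        by (rule sup_norm_nderiv_le_derivatives(2)[OF h n bound E0]) (use 0 in auto)
    next
      case (Suc l)
      show ?case unfolding f
        by (rule sup_norm_nderiv_le_derivatives(2)[OF h n bound E0])
          (use Suc in \<open>auto simp: f\<close>)
    qed
    have step: "sup_norm (nderiv (Suc l) f) \<le> ereal (E l) *
        (sup_norm (nderiv (Suc l) h) + ereal \<bar>\<Sum>i<l. \<alpha> i\<bar> * sup_norm (nderiv l f))" if "l < n" for l
      unfolding f
    proof (rule sup_norm_nderiv_le_derivatives(1)[OF h n bound E0])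
      show "sup_norm (nderiv l (sol 0 h)) < \<infinity>" if "l \<noteq> 0"
        using finite[of "l - 1"] that \<open>l < n\<close> by (cases l) (auto simp: f)
    qed (use that in auto)
    obtain m where m: "n = Suc m" using \<open>1 \<le> n\<close> by (cases n) auto
    \<comment> \<open>The recursion starts at order 1, where the coefficient of the norm of
      \<open>f\<close> is 0; shifting all indices by one then gives the stated sum.\<close>
    have "sup_norm (nderiv (Suc m) f) \<le>
        ereal (E m) * (\<Sum>j=0..m. ereal (\<Prod>i\<in>{j..<m}. E i * s i) * sup_norm (nderiv (Suc j) h))"
    proof (rule ereal_linear_recursion[where x = "\<lambda>k. sup_norm (nderiv (Suc k) f)"
          and y = "\<lambda>k. sup_norm (nderiv (Suc k) h)"])
      show "sup_norm (nderiv (Suc 0) f) \<le> ereal (E 0) * sup_norm (nderiv (Suc 0) h)"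
        using step[of 0] m by (simp flip: zero_ereal_def)
      show "sup_norm (nderiv (Suc (Suc k)) f) \<le> ereal (E (Suc k)) *
          (sup_norm (nderiv (Suc (Suc k)) h) + ereal (s k) * sup_norm (nderiv (Suc k) f))"
        if "k < m" for k
        using step[of "Suc k"] that m unfolding s_Suc by simp
    qed (use E0 s0 sup_norm_nonneg m in auto)
    also have "(\<Sum>j=0..m. ereal (\<Prod>i\<in>{j..<m}. E i * s i) * sup_norm (nderiv (Suc j) h)) =
        (\<Sum>j=1..n. ereal (\<Prod>i\<in>{j..<n}. E (i - 1) * s (i - 1)) * sup_norm (nderiv j h))"
      unfolding m One_nat_def sum.shift_bounds_cl_Suc_ivl prod.shift_bounds_Suc_ivl by simp
    finally show "sup_norm (nderiv n f) \<le> ereal (E (n - 1)) *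
        (\<Sum>j=1..n. ereal (\<Prod>i\<in>{j..<n}. E (i - 1) * s (i - 1)) * sup_norm (nderiv j h))"
      by (simp add: m)
  qed
qed

end
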